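(* Assume that $M\in C^1$, that $f(x,\cdot)\in C^1(\mathbb{R})$ for every $x\in\Omega$, and that $M$ satisfies $(\rho_1)$, $(\rho_2)$ and $(\gamma_1)$, while $f$ satisfies $(f_1)$, $(f_2)$, $(f_3)$. Then there exists a number $\lambda_1^\star>0$ such that for every $\lambda\in(-\infty,\lambda_1^\star)$ the problem $$-M\Big(\int_\Omega|\nabla u|^p\,dx\Big)\Delta_p u=|u|^{p^\star-2}u+\lambda f(x,u)\ \text{in }\Omega,\qquad u=0\ \text{on }\partial\Omega,$$ possesses only the trivial weak solution $u=0$, i.e. $0$ is the only critical point of $\Phi_\lambda$ in $W_0^{1,p}(\Omega)$.
   Context: Let $N$ be a positive integer, $1<p<N$, $p^\star=\frac{pN}{N-p}$, and let $\Omega\subset\mathbb{R}^N$ be a bounded domain with smooth boundary. The space $W_0^{1,p}(\Omega)$ carries the norm $\|u\|=(\int_\Omega|\nabla u|^p\,dx)^{1/p}$, and $\|u\|_s$ denotes the $L^s(\Omega)$-norm. Set $S:=\sup_{u\in W_0^{1,p}(\Omega)\setminus\{0\}}\|u\|_{p^\star}^{p^\star}/\|u\|^{p^\star}$. $M:[0,\infty)\to[0,\infty)$ is continuous with $\hat M(t)=\int_0^tM(s)\,ds$. $f:\Omega\times\mathbb{R}\to\mathbb{R}$ is a Carathéodory function with $F(x,t)=\int_0^tf(x,s)\,ds$. For $\lambda\in\mathbb{R}$ the energy functional is $$\Phi_\lambda(u)=\tfrac1p\hat M(\|u\|^p)-\tfrac1{p^\star}\|u\|_{p^\star}^{p^\star}-\lambda\int_\Omega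 F(x,u)\,dx,\qquad u\in W_0^{1,p}(\Omega),$$ and weak solutions are its critical points. The conditions used are: - $(\rho_1)$: $\lim_{t\to0^+}M(t)>0$. - $(\rho_2)$: $\lim_{t\to+\infty}M(t)/t^{(r-p)/p}>0$ for some $r>p^\star$. - $(\gamma_1)$: $\inf_{t>0}M(t)/t^{\frac{p^\star}{p}-1}>S$. - $(f_1)$: there exist $c_1,c_2>0$ and $q\in(p,p^\star)$ with $|f(x,t)|\le c_1+c_2|t|^{q-1}$ for all $t\in\mathbb{R}$ and a.e. $x\in\Omega$. - $(f_2)$: $\lim_{t\to0}f(x,t)/|t|^{p-1}=0$ uniformly in $x\in\Omega$. - $(f_3)$: for a.e. $x\in\Omega$ one has $f(x,t)>0$ for all $t>0$ and $f(x,t)<0$ for all $t<0$; moreover there exist $\mu>0$ and an open interval $I\subset(0,\infty)$ with $f(x,t)\ge\mu$ for a.e. $x\in\Omega$ and all $t\in I$. *)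

theory Defs
  imports "HOL-Analysis.Analysis"
begin

definition pderiv_dir :: "('a::euclidean_space \<Rightarrow> real) \<Rightarrow> 'a \<Rightarrow> 'a \<Rightarrow> real" where
  "pderiv_dir \<phi> b x = frechet_derivative \<phi> (at x) b"

definition grad :: "('a::euclidean_space \<Rightarrow> real) \<Rightarrow> 'a \<Rightarrow> 'a" where
  "grad \<phi> x = (\<Sum>b\<in>Basis. pderiv_dir \<phi> b x *\<^sub>R b)"

fun Ck :: "nat \<Rightarrow> ('a::euclidean_space \<Rightarrow> real) \<Rightarrow> bool" where
  "Ck 0 \<phi> = continuous_on UNIV \<phi>"
| "Ck (Suc k) \<phi> = (continuous_on UNIV \<phi> \<and> (\<forall>x. \<phi> differentiable (at x)) \<and>
                    (\<forall>b\<in>Basis. Ck k (pderiv_dir \<phi> b)))"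

definition smooth :: "('a::euclidean_space \<Rightarrow> real) \<Rightarrow> bool" where
  "smooth \<phi> \<longleftrightarrow> (\<forall>k. Ck k \<phi>)"

definition test_fun :: "'a::euclidean_space set \<Rightarrow> ('a \<Rightarrow> real) \<Rightarrow> bool" where
  "test_fun \<Omega> \<phi> \<longleftrightarrow> smooth \<phi> \<and> compact (closure {x. \<phi> x \<noteq> 0}) \<and> closure {x. \<phi> x \<noteq> 0} \<subseteq> \<Omega>"

text \<open>Bounded domain with smooth (C-infinity) boundary, via a global defining function.\<close>
definition smooth_bounded_domain :: "'a::euclidean_space set \<Rightarrow> bool" where
  "smooth_bounded_domain \<Omega> \<longleftrightarrow> open \<Omega> \<and> connected \<Omega> \<and> bounded \<Omega> \<and> \<Omega> \<noteq> {} \<and>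
     (\<exists>\<rho>. smooth \<rho> \<and> \<Omega> = {x. \<rho> x < 0} \<and> (\<forall>x\<in>frontier \<Omega>. \<rho> x = 0 \<and> grad \<rho> x \<noteq> 0))"

definition weak_gradient :: "'a::euclidean_space set \<Rightarrow> ('a \<Rightarrow> real) \<Rightarrow> ('a \<Rightarrow> 'a) \<Rightarrow> bool" where
  "weak_gradient \<Omega> u g \<longleftrightarrow>
     (\<forall>\<phi>. test_fun \<Omega> \<phi> \<longrightarrow> (\<forall>b\<in>Basis.
        integrable (lebesgue_on \<Omega>) (\<lambda>x. u x * pderiv_dir \<phi> b x) \<and>
        integrable (lebesgue_on \<Omega>) (\<lambda>x. (g x \<bullet> b) * \<phi> x) \<and>
        (\<integral>x. u x * pderiv_dir \<phi> b x \<partial>lebesgue_on \<Omega>) = - (\<integral>x. (g x \<bullet> b) * \<phi> x \<partial>lebesgue_on \<Omega>)))"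

definition sobolev :: "real \<Rightarrow> 'a::euclidean_space set \<Rightarrow> ('a \<Rightarrow> real) \<Rightarrow> ('a \<Rightarrow> 'a) \<Rightarrow> bool" where
  "sobolev p \<Omega> u g \<longleftrightarrow>
     u \<in> borel_measurable (lebesgue_on \<Omega>) \<and> g \<in> borel_measurable (lebesgue_on \<Omega>) \<and>
     integrable (lebesgue_on \<Omega>) (\<lambda>x. \<bar>u x\<bar> powr p) \<and>
     integrable (lebesgue_on \<Omega>) (\<lambda>x. norm (g x) powr p) \<and>
     weak_gradient \<Omega> u g"

definition sobolev0 :: "real \<Rightarrow> 'a::euclidean_space set \<Rightarrow> ('a \<Rightarrow> real) \<Rightarrow> ('a \<Rightarrow> 'a) \<Rightarrow> bool" where
  "sobolev0 p \<Omega> u g \<longleftrightarrow> sobolev p \<Omega> u g \<and>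
     (\<exists>\<phi>::nat \<Rightarrow> 'a \<Rightarrow> real. (\<forall>k. test_fun \<Omega> (\<phi> k)) \<and>
        (\<lambda>k. \<integral>x. \<bar>\<phi> k x - u x\<bar> powr p \<partial>lebesgue_on \<Omega>) \<longlonglongrightarrow> 0 \<and>
        (\<lambda>k. \<integral>x. norm (grad (\<phi> k) x - g x) powr p \<partial>lebesgue_on \<Omega>) \<longlonglongrightarrow> 0)"

definition grad_norm_p :: "real \<Rightarrow> 'a::euclidean_space set \<Rightarrow> ('a \<Rightarrow> 'a) \<Rightarrow> real" where
  "grad_norm_p p \<Omega> g = (\<integral>x. norm (g x) powr p \<partial>lebesgue_on \<Omega>)"

definition crit_exp :: "real \<Rightarrow> nat \<Rightarrow> real" where
  "crit_exp p N = p * real N / (real N - p)"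

definition sobolev_S :: "real \<Rightarrow> 'a::euclidean_space set \<Rightarrow> real" where
  "sobolev_S p \<Omega> = (let ps = crit_exp p DIM('a) in
     Sup {(\<integral>x. \<bar>u x\<bar> powr ps \<partial>lebesgue_on \<Omega>) / (grad_norm_p p \<Omega> g) powr (ps / p) | u g.
          sobolev0 p \<Omega> u g \<and> grad_norm_p p \<Omega> g > 0})"

text \<open>Weak solution of  -M(\<integral>|\<nabla>u|^p) \<Delta>_p u = |u|^{p*-2}u + \<lambda> f(x,u), u = 0 on the boundary;
  equivalently a critical point of \<Phi>_\<lambda>.\<close>
definition weak_solution ::
  "real \<Rightarrow> 'a::euclidean_space set \<Rightarrow> (real \<Rightarrow> real) \<Rightarrow> ('a \<Rightarrow> real \<Rightarrow> real) \<Rightarrow> real \<Rightarrow>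
   ('a \<Rightarrow> real) \<Rightarrow> ('a \<Rightarrow> 'a) \<Rightarrow> bool" where
  "weak_solution p \<Omega> M f lam u g \<longleftrightarrow> sobolev0 p \<Omega> u g \<and>
     (\<forall>\<phi> \<psi>. sobolev0 p \<Omega> \<phi> \<psi> \<longrightarrow>
        M (grad_norm_p p \<Omega> g) * (\<integral>x. norm (g x) powr (p - 2) * (g x \<bullet> \<psi> x) \<partial>lebesgue_on \<Omega>)
        = (\<integral>x. \<bar>u x\<bar> powr (crit_exp p DIM('a) - 2) * u x * \<phi> x \<partial>lebesgue_on \<Omega>)
          + lam * (\<integral>x. f x (u x) * \<phi> x \<partial>lebesgue_on \<Omega>))"

end

theory Submission
  imports Defs
begin

text \<open>
  Testing the equation with the solution itself, and writing \<open>T\<close> for the integral of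
  \<open>|\<nabla>u|^p\<close>, gives \<open>M(T) T = \<integral>|u|^p* + \<lambda> \<integral>f(x,u)u\<close>. By the definition of \<open>S\<close> the first
  integral is at most \<open>S T^(p*/p)\<close>, while \<open>(\<rho>\<^sub>1)\<close> and \<open>(\<gamma>\<^sub>1)\<close> give
  \<open>M(T) T \<ge> S T^(p*/p) + c (T + T^(p*/p))\<close>. By \<open>(f\<^sub>1)\<close>, \<open>(f\<^sub>2)\<close> and \<open>(f\<^sub>3)\<close> the second integral lies
  between \<open>0\<close> and a multiple of \<open>T + T^(p*/p)\<close>, so \<open>T > 0\<close> is impossible for small \<open>\<lambda>\<close>.

  The supremum defining \<open>S\<close> is meaningful only because of the Sobolev inequality. That is proved
  for test functions by the Gagliardo-Nirenberg argument: \<open>|\<phi>|^\<gamma>\<close> is bounded by the integral of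
  its gradient along every coordinate line, and the product of these line integrals is controlled
  by applying Hoelder's inequality one coordinate at a time.
\<close>

section \<open>Powers of extended nonnegative reals and the Hoelder inequality\<close>

text \<open>The convention \<open>\<infinity>\<^sup>0 = 0\<^sup>0 = 1\<close> is needed below, whereas \<open>0 powr 0 = 0\<close> on the reals.\<close>
definition epowr :: "ennreal \<Rightarrow> real \<Rightarrow> ennreal" where
  "epowr x a = (if a = 0 then 1 else if x = \<infinity> then \<infinity> else ennreal (enn2real x powr a))"

lemma epowr_0 [simp]: "epowr x 0 = 1"
  by (simp add: epowr_def)

lemma epowr_top [simp]: "a \<noteq> 0 \<Longrightarrow> epowr top a = top"
  by (simp add: epowr_def)

lemma epowr_ennreal: "0 \<le> x \<Longrightarrow> a \<noteq> 0 \<Longrightarrow> epowr (ennreal x) a = ennreal (x powr a)"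
  by (simp add: epowr_def)

lemma epowr_eq_0_iff: "epowr x a = 0 \<longleftrightarrow> x = 0 \<and> a \<noteq> 0"
  by (cases x) (auto simp: epowr_def)

lemma epowr_add:
  assumes "0 \<le> a" "0 \<le> b"
  shows "epowr x (a + b) = epowr x a * epowr x b"
proof (cases "a = 0 \<or> b = 0")
  case False
  then show ?thesis using assms
    by (cases x) (auto simp: epowr_def powr_add ennreal_mult)
qed auto

lemma epowr_mono: "0 \<le> a \<Longrightarrow> x \<le> y \<Longrightarrow> epowr x a \<le> epowr y a"
  by (cases x; cases y) (auto simp: epowr_def powr_mono2 ennreal_leI top_unique)

lemma measurable_epowr [measurable]:
  assumes [measurable]: "f \<in> borel_measurable M"
  shows "(\<lambda>x. epowr (f x) a) \<in> borel_measurable M"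
  unfolding epowr_def by measurable

text \<open>Jensen's inequality for the concave function \<open>ln\<close>. A vanishing
  \<open>x i\<close> has no logarithm and is split off; it makes the product zero.\<close>

lemma weighted_arith_geom_mean:
  fixes x w :: "'i \<Rightarrow> real"
  assumes "finite I" and w: "\<And>i. i \<in> I \<Longrightarrow> 0 < w i" "(\<Sum>i\<in>I. w i) = 1"
    and x: "\<And>i. i \<in> I \<Longrightarrow> 0 \<le> x i"
  shows "(\<Prod>i\<in>I. x i powr w i) \<le> (\<Sum>i\<in>I. w i * x i)"
proof (cases "\<exists>i\<in>I. x i = 0")
  case True
  then have "(\<Prod>i\<in>I. x i powr w i) = 0"
    using \<open>finite I\<close> by (subst prod_zero_iff) auto
  then show ?thesis
    using w x by (simp add: sum_nonneg less_imp_le)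
next
  case False
  then have pos: "\<And>i. i \<in> I \<Longrightarrow> 0 < x i"
    using x by (force simp: less_le)
  have ne: "I \<noteq> {}" using w(2) by auto
  have spos: "0 < (\<Sum>i\<in>I. w i * x i)"
    using \<open>finite I\<close> ne w pos by (intro sum_pos) auto
  have "(\<Sum>i\<in>I. w i * ln (x i)) \<le> ln (\<Sum>i\<in>I. w i * x i)"
    using concave_on_sum[OF \<open>finite I\<close> ne ln_concave w(2), of x] w pos
    by (auto simp: less_imp_le)
  then have "exp (\<Sum>i\<in>I. w i * ln (x i)) \<le> (\<Sum>i\<in>I. w i * x i)"
    using spos by (simp add: ln_ge_iff)
  also have "exp (\<Sum>i\<in>I. w i * ln (x i)) = (\<Prod>i\<in>I. x i powr w i)"
    using \<open>finite I\<close> pos by (auto simp: exp_sum powr_def dual_order.strict_implies_not_eq intro!: prod.cong)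
  finally show ?thesis .
qed

text \<open>Each \<open>f i\<close> is divided by its integral and the weighted arithmetic-geometric
  mean inequality is applied pointwise. After integration the sum on the right becomes the sum of
  the weights, which is 1. Integrals equal to 0 or to infinity cannot be divided by and are treated
  first.\<close>

lemma Holder_nn_integral_pos_weights:
  fixes f :: "'i \<Rightarrow> 'b \<Rightarrow> ennreal"
  assumes I: "finite I" and w: "\<And>i. i \<in> I \<Longrightarrow> 0 < w i" "(\<Sum>i\<in>I. w i) = 1"
    and f[measurable]: "\<And>i. i \<in> I \<Longrightarrow> f i \<in> borel_measurable M"
  shows "(\<integral>\<^sup>+x. (\<Prod>i\<in>I. epowr (f i x) (w i)) \<partial>M) \<le> (\<Prod>i\<in>I. epowr (\<integral>\<^sup>+x. f i x \<partial>M) (w i))"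
proof (cases "\<exists>i\<in>I. (\<integral>\<^sup>+x. f i x \<partial>M) = 0")
  case True
  then obtain i where i: "i \<in> I" "(\<integral>\<^sup>+x. f i x \<partial>M) = 0" by auto
  have "AE x in M. f i x = 0"
    using i f by (simp add: nn_integral_0_iff_AE)
  then have "AE x in M. (\<Prod>i\<in>I. epowr (f i x) (w i)) = 0"
  proof eventually_elim
    case (elim x)
    then have "epowr (f i x) (w i) = 0"
      using i(1) w(1)[of i] by (simp add: epowr_eq_0_iff)
    then show ?case
      using I i(1) by (auto simp: prod_zero_iff)
  qed
  then have "(\<integral>\<^sup>+x. (\<Prod>i\<in>I. epowr (f i x) (w i)) \<partial>M) = (\<integral>\<^sup>+x. 0 \<partial>M)"
    by (rule nn_integral_cong_AE)
  then show ?thesis by simp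
next
  case nz: False
  define c where "c i = (\<integral>\<^sup>+x. f i x \<partial>M)" for i
  have nzp: "(\<Prod>i\<in>J. epowr (c i) (w i)) \<noteq> 0" if "J \<subseteq> I" for J
    using that nz I finite_subset[OF that I] by (auto simp: prod_zero_iff epowr_eq_0_iff c_def)
  show ?thesis
  proof (cases "\<exists>i\<in>I. c i = top")
    case True
    then obtain i where i: "i \<in> I" "c i = top" by auto
    \<comment> \<open>One infinite factor makes the whole product infinite, because
      \<open>nzp\<close> excludes the form infinity times zero.\<close>
    have "(\<Prod>i\<in>I. epowr (c i) (w i)) = epowr (c i) (w i) * (\<Prod>i\<in>I-{i}. epowr (c i) (w i))"
      using I i by (simp add: prod.remove)
    also have "\<dots> = top"
      using i w(1)[of i] nzp[of "I - {i}"] by (auto simp: ennreal_top_mult)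
    finally show ?thesis by (simp add: c_def)
  next
    case False
    define r where "r i = enn2real (c i)" for i
    have cr: "c i = ennreal (r i)" "0 < r i" if "i \<in> I" for i
      using that False nz by (auto simp: r_def c_def enn2real_positive_iff less_top zero_less_iff_neq_zero)
    let ?P = "\<Prod>i\<in>I. epowr (c i) (w i)"
    have P: "?P = ennreal (\<Prod>i\<in>I. r i powr w i)"
    proof -
      have "?P = (\<Prod>i\<in>I. ennreal (r i powr w i))"
        using cr w(1) by (intro prod.cong refl) (auto simp: epowr_ennreal less_imp_le dual_order.strict_implies_not_eq)
      then show ?thesis using I by (simp add: prod_ennreal)
    qed
    have Ppos: "0 < (\<Prod>i\<in>I. r i powr w i)"
      using cr by (intro prod_pos) force
    \<comment> \<open>The mean inequality for the normalized values \<open>f i x / r i\<close>. If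
      some value is infinite, so is the right side, since \<open>?P\<close> and all
      \<open>w i / r i\<close> are positive.\<close>
    have pw: "(\<Prod>i\<in>I. epowr (f i x) (w i)) \<le> ?P * (\<Sum>i\<in>I. ennreal (w i / r i) * f i x)" for x
    proof (cases "\<exists>i\<in>I. f i x = top")
      case True
      then obtain i where i: "i \<in> I" "f i x = top" by auto
      have "ennreal (w i / r i) * f i x = top"
        using i w(1)[of i] cr(2)[of i] by (simp add: ennreal_mult_top)
      then have "(\<Sum>i\<in>I. ennreal (w i / r i) * f i x) = top"
        using I i by (auto simp: sum.remove)
      then show ?thesis using Ppos P by (simp add: ennreal_mult_top)
    next
      case fin: False
      define y where "y i = enn2real (f i x)" for i
      have fy: "f i x = ennreal (y i)" "0 \<le> y i" if "i \<in> I" for i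
        using that fin by (auto simp: y_def less_top)
      have "(\<Prod>i\<in>I. epowr (f i x) (w i)) = (\<Prod>i\<in>I. ennreal (y i powr w i))"
        using fy w(1) by (intro prod.cong refl) (auto simp: epowr_ennreal dual_order.strict_implies_not_eq)
      also have "\<dots> = ennreal (\<Prod>i\<in>I. y i powr w i)"
        using I by (simp add: prod_ennreal)
      also have "(\<Prod>i\<in>I. y i powr w i) = (\<Prod>i\<in>I. r i powr w i * (y i / r i) powr w i)"
        using cr fy by (intro prod.cong refl) (auto simp: powr_divide less_imp_le dual_order.strict_implies_not_eq)
      also have "\<dots> = (\<Prod>i\<in>I. r i powr w i) * (\<Prod>i\<in>I. (y i / r i) powr w i)"
        by (simp add: prod.distrib)
      also have "\<dots> \<le> (\<Prod>i\<in>I. r i powr w i) * (\<Sum>i\<in>I. w i * (y i / r i))"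
        using Ppos w fy cr I
        by (intro mult_left_mono weighted_arith_geom_mean) (auto simp: less_imp_le)
      finally have "(\<Prod>i\<in>I. epowr (f i x) (w i)) \<le> ennreal ((\<Prod>i\<in>I. r i powr w i) * (\<Sum>i\<in>I. w i * (y i / r i)))"
        by (simp add: ennreal_leI)
      also have "\<dots> = ?P * ennreal (\<Sum>i\<in>I. w i * (y i / r i))"
        using Ppos P fy w cr by (subst ennreal_mult) (auto intro!: sum_nonneg simp: less_imp_le)
      also have "ennreal (\<Sum>i\<in>I. w i * (y i / r i)) = (\<Sum>i\<in>I. ennreal (w i * (y i / r i)))"
        using fy w cr by (subst sum_ennreal) (auto simp: less_imp_le)
      also have "\<dots> = (\<Sum>i\<in>I. ennreal (w i / r i) * f i x)"
        using fy w cr by (intro sum.cong refl) (auto simp: ennreal_mult[symmetric] less_imp_le)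
      finally show ?thesis .
    qed
    have "(\<integral>\<^sup>+x. (\<Prod>i\<in>I. epowr (f i x) (w i)) \<partial>M) \<le> (\<integral>\<^sup>+x. ?P * (\<Sum>i\<in>I. ennreal (w i / r i) * f i x) \<partial>M)"
      by (intro nn_integral_mono pw)
    also have "\<dots> = ?P * (\<Sum>i\<in>I. ennreal (w i / r i) * c i)"
      by (simp add: nn_integral_cmult nn_integral_sum c_def)
    also have "(\<Sum>i\<in>I. ennreal (w i / r i) * c i) = (\<Sum>i\<in>I. ennreal (w i))"
      using cr w(1) by (intro sum.cong refl) (auto simp: ennreal_mult[symmetric] less_imp_le dual_order.strict_implies_not_eq)
    also have "\<dots> = 1"
      using w by (subst sum_ennreal) (auto simp: less_imp_le)
    finally show ?thesis by (simp add: c_def)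
  qed
qed

lemma Holder_nn_integral:
  fixes f :: "'i \<Rightarrow> 'b \<Rightarrow> ennreal"
  assumes I: "finite I" and w: "\<And>i. i \<in> I \<Longrightarrow> 0 \<le> w i" "(\<Sum>i\<in>I. w i) = 1"
    and f[measurable]: "\<And>i. i \<in> I \<Longrightarrow> f i \<in> borel_measurable M"
  shows "(\<integral>\<^sup>+x. (\<Prod>i\<in>I. epowr (f i x) (w i)) \<partial>M) \<le> (\<Prod>i\<in>I. epowr (\<integral>\<^sup>+x. f i x \<partial>M) (w i))"
proof -
  let ?J = "{i\<in>I. w i \<noteq> 0}"
  have eq: "(\<Prod>i\<in>I. epowr (g i) (w i)) = (\<Prod>i\<in>?J. epowr (g i) (w i))" for g
    using I by (intro prod.mono_neutral_right) auto
  have "(\<Sum>i\<in>?J. w i) = 1"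
    using I w(2) by (subst sum.mono_neutral_left[of I]) auto
  then show ?thesis
    unfolding eq using I w f by (intro Holder_nn_integral_pos_weights) (auto simp: less_le)
qed

text \<open>The shape needed for the induction over directions: one distinguished function with
  weight \<open>a\<close>, all others with the common weight \<open>q\<close>. The option type
  provides a fresh index \<open>None\<close> for the distinguished function.\<close>

lemma Holder_nn_integral_insert:
  fixes f :: "'i \<Rightarrow> 'b \<Rightarrow> ennreal" and a q :: real
  assumes I: "finite I" and w: "0 \<le> a" "0 \<le> q" "a + card I * q = 1"
    and [measurable]: "h \<in> borel_measurable M" "\<And>i. i \<in> I \<Longrightarrow> f i \<in> borel_measurable M"
  shows "(\<integral>\<^sup>+x. epowr (h x) a * (\<Prod>i\<in>I. epowr (f i x) q) \<partial>M)
    \<le> epowr (\<integral>\<^sup>+x. h x \<partial>M) a * (\<Prod>i\<in>I. epowr (\<integral>\<^sup>+x. f i x \<partial>M) q)"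
proof -
  have *: "(\<Prod>i\<in>insert None (Some ` I). epowr (case_option H F i) (case_option a (\<lambda>_. q) i))
      = epowr H a * (\<Prod>i\<in>I. epowr (F i) q)" for H and F :: "'i \<Rightarrow> ennreal"
    using I by (subst prod.insert) (auto simp: prod.reindex)
  have [measurable]: "case_option h f i \<in> borel_measurable M" if "i \<in> insert None (Some ` I)" for i
    using that by auto
  have "(\<integral>\<^sup>+x. (\<Prod>i\<in>insert None (Some ` I). epowr (case_option h f i x) (case_option a (\<lambda>_. q) i)) \<partial>M)
     \<le> (\<Prod>i\<in>insert None (Some ` I). epowr (\<integral>\<^sup>+x. case_option h f i x \<partial>M) (case_option a (\<lambda>_. q) i))"
    using I w by (intro Holder_nn_integral) (auto simp: sum.reindex)
  moreover have "case_option h f i x = case_option (h x) (\<lambda>i. f i x) i" for i x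
    by (cases i) auto
  moreover have "(\<integral>\<^sup>+x. case_option (h x) (\<lambda>i. f i x) i \<partial>M)
      = case_option (\<integral>\<^sup>+x. h x \<partial>M) (\<lambda>i. \<integral>\<^sup>+x. f i x \<partial>M) i" for i
    by (cases i) auto
  ultimately show ?thesis by (simp only: *)
qed

section \<open>Integrals along coordinate lines\<close>

definition line_integral :: "'a::euclidean_space \<Rightarrow> ('a \<Rightarrow> ennreal) \<Rightarrow> 'a \<Rightarrow> ennreal" where
  "line_integral b f x = (\<integral>\<^sup>+t. f (x + t *\<^sub>R b) \<partial>lborel)"

fun iterated_line_integral :: "'a::euclidean_space list \<Rightarrow> ('a \<Rightarrow> ennreal) \<Rightarrow> 'a \<Rightarrow> ennreal" where
  "iterated_line_integral [] f = f"
| "iterated_line_integral (b # bs) f = iterated_line_integral bs (line_integral b f)"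

lemma measurable_line_integral [measurable]:
  fixes f :: "'a::euclidean_space \<Rightarrow> ennreal"
  assumes [measurable]: "f \<in> borel_measurable borel"
  shows "line_integral b f \<in> borel_measurable borel"
proof -
  have "(\<lambda>x. \<integral>\<^sup>+t. f (x + t *\<^sub>R b) \<partial>lborel) \<in> borel_measurable borel"
    by measurable
  then show ?thesis unfolding line_integral_def[abs_def] .
qed

lemma line_integral_commute:
  fixes f :: "'a::euclidean_space \<Rightarrow> ennreal"
  assumes [measurable]: "f \<in> borel_measurable borel"
  shows "line_integral a (line_integral b f) = line_integral b (line_integral a f)"
proof
  fix x
  have "(\<integral>\<^sup>+s. \<integral>\<^sup>+t. f (x + s *\<^sub>R a + t *\<^sub>R b) \<partial>lborel \<partial>lborel)
      = (\<integral>\<^sup>+t. \<integral>\<^sup>+s. f (x + s *\<^sub>R a + t *\<^sub>R b) \<partial>lborel \<partial>lborel)"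
    by (rule lborel_pair.Fubini') measurable
  then show "line_integral a (line_integral b f) x = line_integral b (line_integral a f) x"
    by (simp add: line_integral_def ac_simps)
qed

text \<open>Translation invariance of Lebesgue measure. Thus \<open>line_integral b f\<close> is
  constant along direction \<open>b\<close> and may be pulled out of a further integral in that
  direction.\<close>

lemma line_integral_translate:
  fixes f :: "'a::euclidean_space \<Rightarrow> ennreal"
  assumes [measurable]: "f \<in> borel_measurable borel"
  shows "line_integral b f (x + t *\<^sub>R b) = line_integral b f x"
proof -
  have "(\<integral>\<^sup>+s. f (x + s *\<^sub>R b) \<partial>lborel) = (\<integral>\<^sup>+s. f (x + s *\<^sub>R b) \<partial>distr lborel borel ((+) t))"
    by (simp add: lborel_distr_plus)
  also have "\<dots> = (\<integral>\<^sup>+s. f (x + (t + s) *\<^sub>R b) \<partial>lborel)"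
    by (subst nn_integral_distr) measurable
  finally show ?thesis
    by (simp add: line_integral_def scaleR_add_left add.assoc)
qed

lemma iterated_line_integral_mono:
  "(\<And>x. f x \<le> g x) \<Longrightarrow> iterated_line_integral L f x \<le> iterated_line_integral L g x"
proof (induction L arbitrary: f g)
  case (Cons b L)
  have "line_integral b f y \<le> line_integral b g y" for y
    using Cons.prems by (auto simp: line_integral_def intro!: nn_integral_mono)
  then show ?case using Cons.IH by simp
qed simp

text \<open>
  The exponents are chosen so that Hoelder along direction \<open>b\<close> applies with weights summing to 1, and
  turns the claim for \<open>f\<close> and \<open>b # bs\<close> into the one for \<open>line_integral b f\<close> and \<open>bs\<close>.
\<close>
lemma iterated_line_integral_grid:
  fixes f :: "'a::euclidean_space \<Rightarrow> ennreal"
  assumes "distinct L" "0 \<le> q" "(real (length L) - 1) * q \<le> 1"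
    and "f \<in> borel_measurable borel"
  shows "iterated_line_integral L
      (\<lambda>x. epowr (f x) (1 - (real (length L) - 1) * q) * (\<Prod>i\<in>set L. epowr (line_integral i f x) q)) x
    \<le> epowr (iterated_line_integral L f x) (1 + q)"
  using assms
proof (induction L arbitrary: f)
  \<comment> \<open>For the empty list the exponent \<open>1 - (0 - 1) * q\<close> is already
    \<open>1 + q\<close>, and the two sides agree.\<close>
  case Nil
  then show ?case by simp
next
  case (Cons b bs)
  note [measurable] = Cons.prems(4)
  let ?F = "line_integral b f"
  have le: "(real (length bs) - 1) * q \<le> 1"
    using Cons.prems by (simp add: algebra_simps)
  have step: "line_integral b (\<lambda>x. epowr (f x) (1 - (real (length (b # bs)) - 1) * q)
        * (\<Prod>i\<in>set (b # bs). epowr (line_integral i f x) q)) x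
      \<le> epowr (?F x) (1 - (real (length bs) - 1) * q) * (\<Prod>i\<in>set bs. epowr (line_integral i ?F x) q)" for x
  proof -
    have "line_integral b (\<lambda>x. epowr (f x) (1 - (real (length (b # bs)) - 1) * q)
        * (\<Prod>i\<in>set (b # bs). epowr (line_integral i f x) q)) x
      = (\<integral>\<^sup>+t. epowr (?F x) q * (epowr (f (x + t *\<^sub>R b)) (1 - length bs * q)
          * (\<Prod>i\<in>set bs. epowr (line_integral i f (x + t *\<^sub>R b)) q)) \<partial>lborel)"
      \<comment> \<open>The factor belonging to \<open>b\<close> itself does not depend on
        \<open>t\<close>. It leaves the integral and is merged, after Hoelder, with the power of
        \<open>?F\<close> that comes from \<open>f\<close>.\<close>
      using Cons.prems by (subst line_integral_def) (simp add: line_integral_translate ac_simps)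
    also have "\<dots> = epowr (?F x) q * (\<integral>\<^sup>+t. epowr (f (x + t *\<^sub>R b)) (1 - length bs * q)
          * (\<Prod>i\<in>set bs. epowr (line_integral i f (x + t *\<^sub>R b)) q) \<partial>lborel)"
      by (rule nn_integral_cmult) measurable
    also have "\<dots> \<le> epowr (?F x) q * (epowr (\<integral>\<^sup>+t. f (x + t *\<^sub>R b) \<partial>lborel) (1 - length bs * q)
          * (\<Prod>i\<in>set bs. epowr (\<integral>\<^sup>+t. line_integral i f (x + t *\<^sub>R b) \<partial>lborel) q))"
      using Cons.prems
      by (intro mult_left_mono Holder_nn_integral_insert) (auto simp: distinct_card)
    also have "\<dots> = epowr (?F x) (q + (1 - length bs * q)) * (\<Prod>i\<in>set bs. epowr (line_integral b (line_integral i f) x) q)"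
      using Cons.prems by (subst epowr_add) (auto simp: line_integral_def mult.assoc)
    also have "q + (1 - length bs * q) = 1 - (real (length bs) - 1) * q"
      by (simp add: algebra_simps)
    finally show ?thesis
      by (simp add: line_integral_commute[of f b])
  qed
  have "iterated_line_integral (b # bs)
      (\<lambda>x. epowr (f x) (1 - (real (length (b # bs)) - 1) * q) * (\<Prod>i\<in>set (b # bs). epowr (line_integral i f x) q)) x
    \<le> iterated_line_integral bs (\<lambda>x. epowr (?F x) (1 - (real (length bs) - 1) * q)
        * (\<Prod>i\<in>set bs. epowr (line_integral i ?F x) q)) x"
    unfolding iterated_line_integral.simps by (rule iterated_line_integral_mono, rule step)
  also have "\<dots> \<le> epowr (iterated_line_integral bs ?F x) (1 + q)"
    using Cons.prems le by (intro Cons.IH) auto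
  finally show ?case by simp
qed

text \<open>Tonelli's theorem, one coordinate at a time. The base point \<open>x\<close> stays
  general because the induction integrates \<open>line_integral b f\<close> from points displaced in
  the remaining directions.\<close>

lemma iterated_line_integral_PiM:
  fixes f :: "'a::euclidean_space \<Rightarrow> ennreal"
  assumes "distinct L" "f \<in> borel_measurable borel"
  shows "iterated_line_integral L f x
    = (\<integral>\<^sup>+w. f (x + (\<Sum>b\<in>set L. w b *\<^sub>R b)) \<partial>(\<Pi>\<^sub>M b\<in>set L. lborel))"
  using assms
proof (induction L arbitrary: f)
  case Nil
  then show ?case by (simp add: PiM_empty nn_integral_count_space_finite)
next
  case (Cons b bs)
  note [measurable] = Cons.prems(2)
  interpret product_sigma_finite "\<lambda>_::'a. lborel::real measure"
    by standard
  \<comment> \<open>Distinctness of the list keeps \<open>b\<close> out of \<open>bs\<close>, so the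
    update is invisible to this sum.\<close>
  have upd: "(\<Sum>c\<in>set bs. (w(b := y)) c *\<^sub>R c) = (\<Sum>c\<in>set bs. w c *\<^sub>R c)" for w :: "'a \<Rightarrow> real" and y
    using Cons.prems by (intro sum.cong) auto
  have "iterated_line_integral (b # bs) f x
      = (\<integral>\<^sup>+w. line_integral b f (x + (\<Sum>b\<in>set bs. w b *\<^sub>R b)) \<partial>(\<Pi>\<^sub>M b\<in>set bs. lborel))"
    using Cons by simp
  also have "\<dots> = (\<integral>\<^sup>+w. (\<integral>\<^sup>+y. f (x + (\<Sum>c\<in>set (b # bs). (w(b := y)) c *\<^sub>R c)) \<partial>lborel) \<partial>(\<Pi>\<^sub>M b\<in>set bs. lborel))"
    using Cons.prems by (simp add: line_integral_def upd ac_simps del: fun_upd_apply add: fun_upd_same)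
  also have "\<dots> = (\<integral>\<^sup>+w. f (x + (\<Sum>b\<in>set (b # bs). w b *\<^sub>R b)) \<partial>(\<Pi>\<^sub>M b\<in>insert b (set bs). lborel))"
    using Cons.prems by (subst product_nn_integral_insert) auto
  finally show ?case by simp
qed

lemma nn_integral_lborel_iterated:
  fixes f :: "'a::euclidean_space \<Rightarrow> ennreal"
  assumes [measurable]: "f \<in> borel_measurable borel" and L: "distinct L" "set L = Basis"
  shows "(\<integral>\<^sup>+x. f x \<partial>lborel) = iterated_line_integral L f 0"
proof -
  have "(\<integral>\<^sup>+x. f x \<partial>lborel) = (\<integral>\<^sup>+w. f (\<Sum>b\<in>Basis. w b *\<^sub>R b) \<partial>(\<Pi>\<^sub>M b\<in>(Basis::'a set). lborel))"
    by (subst lborel_eq) (rule nn_integral_distr; measurable)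
  then show ?thesis
    using L by (simp add: iterated_line_integral_PiM)
qed

text \<open>Gagliardo's form of the Loomis-Whitney inequality, with all functions arising as line
  integrals of the same \<open>f\<close>.\<close>

lemma nn_integral_prod_line_integrals_le:
  fixes f :: "'a::euclidean_space \<Rightarrow> ennreal"
  assumes [measurable]: "f \<in> borel_measurable borel" and N: "2 \<le> DIM('a)"
  shows "(\<integral>\<^sup>+x. (\<Prod>b\<in>Basis. epowr (line_integral b f x) (1 / (real DIM('a) - 1))) \<partial>lborel)
    \<le> epowr (\<integral>\<^sup>+x. f x \<partial>lborel) (real DIM('a) / (real DIM('a) - 1))"
proof -
  obtain L :: "'a list" where L: "set L = Basis" "distinct L"
    using finite_distinct_list[OF finite_Basis] by auto
  have len: "length L = DIM('a)"
    using L distinct_card by fastforce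
  \<comment> \<open>With this \<open>q\<close> the exponent of \<open>f\<close> in the grid
    inequality is 0, so only the line integrals remain on the left.\<close>
  define q where "q = 1 / (real DIM('a) - 1)"
  have q: "(real (length L) - 1) * q = 1" "1 + q = real DIM('a) / (real DIM('a) - 1)" "0 \<le> q"
    using N by (auto simp: len q_def field_simps)
  have "(\<integral>\<^sup>+x. (\<Prod>b\<in>Basis. epowr (line_integral b f x) q) \<partial>lborel)
    = iterated_line_integral L (\<lambda>x. \<Prod>b\<in>Basis. epowr (line_integral b f x) q) 0"
    using L by (intro nn_integral_lborel_iterated) auto
  also have "\<dots> \<le> epowr (iterated_line_integral L f 0) (1 + q)"
    using iterated_line_integral_grid[of L q f 0] L q by simp
  also have "iterated_line_integral L f 0 = (\<integral>\<^sup>+x. f x \<partial>lborel)"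
    using L by (intro nn_integral_lborel_iterated[symmetric]) auto
  finally show ?thesis unfolding q(2) unfolding q_def .
qed

section \<open>The Gagliardo-Nirenberg-Sobolev inequality\<close>

text \<open>Away from 0 this is the usual power rule on either side. At 0 the difference quotient is
  at most \<open>\<bar>h\<bar> powr (a - 1)\<close> in absolute value, which tends to 0 because
  \<open>a > 1\<close>.\<close>

lemma has_real_derivative_abs_powr:
  fixes s a :: real
  assumes "1 < a"
  shows "((\<lambda>s. \<bar>s\<bar> powr a) has_real_derivative a * (sgn s * \<bar>s\<bar> powr (a - 1))) (at s)"
proof -
  consider "0 < s" | "s < 0" | "s = 0" by linarith
  then show ?thesis
  proof cases
    case 1
    have "((\<lambda>s. s powr a) has_real_derivative a * (sgn s * \<bar>s\<bar> powr (a - 1))) (at s)"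
      using 1 by (auto intro!: derivative_eq_intros)
    then show ?thesis
      by (rule has_field_derivative_transform_within_open[of _ _ _ "{0<..}"]) (use 1 in auto)
  next
    case 2
    have "((\<lambda>s. (- s) powr a) has_real_derivative a * (sgn s * \<bar>s\<bar> powr (a - 1))) (at s)"
      using 2 by (auto intro!: derivative_eq_intros)
    then show ?thesis
      by (rule has_field_derivative_transform_within_open[of _ _ _ "{..<0}"]) (use 2 in auto)
  next
    case 3
    have lim: "((\<lambda>h::real. \<bar>h\<bar> powr (a - 1)) \<longlongrightarrow> 0) (at 0)"
      using assms by (intro tendsto_zero_powrI[where b="a - 1"] tendsto_rabs_zero tendsto_ident_at tendsto_const) auto
    have "((\<lambda>h::real. \<bar>h\<bar> powr a / h) \<longlongrightarrow> 0) (at 0)"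
    proof (rule Lim_null_comparison[OF _ lim])
      show "\<forall>\<^sub>F h in at 0. norm (\<bar>h\<bar> powr a / h) \<le> \<bar>h\<bar> powr (a - 1)"
        using eventually_at_ball'[of 1 0 UNIV] by (auto simp: powr_diff eventually_at intro!: exI[of _ 1])
    qed
    then show ?thesis using 3 by (simp add: has_field_derivative_iff)
  qed
qed

text \<open>Written as the difference of powers of the positive and the negative part, the function
  loses the jump of \<open>sgn\<close> at 0.\<close>

lemma continuous_on_sgn_abs_powr:
  fixes a :: real
  assumes "0 < a"
  shows "continuous_on UNIV (\<lambda>s::real. sgn s * \<bar>s\<bar> powr a)"
proof -
  have "(\<lambda>s::real. sgn s * \<bar>s\<bar> powr a) = (\<lambda>s. max s 0 powr a - max (- s) 0 powr a)"
    using assms by (auto simp: fun_eq_iff sgn_if max_def)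
  moreover have "continuous_on UNIV (\<lambda>s::real. max s 0 powr a - max (- s) 0 powr a)"
    using assms by (intro continuous_on_diff continuous_on_powr' continuous_intros) auto
  ultimately show ?thesis by metis
qed

text \<open>No domain enters: the inequality is proved on the whole space and passes to
  \<open>\<Omega>\<close> because test functions vanish outside it.\<close>

definition C1_bounded_support :: "('a::euclidean_space \<Rightarrow> real) \<Rightarrow> bool" where
  "C1_bounded_support \<phi> \<longleftrightarrow> Ck 1 \<phi> \<and> bounded {x. \<phi> x \<noteq> 0}"

lemma prod_mono_ennreal:
  fixes f g :: "'i \<Rightarrow> ennreal"
  assumes "\<And>i. i \<in> I \<Longrightarrow> f i \<le> g i"
  shows "prod f I \<le> prod g I"
  using assms by (induction I rule: infinite_finite_induct) (auto intro!: mult_mono)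

section \<open>Gradients and derivatives along coordinate lines\<close>

lemma grad_inner_Basis: "b \<in> Basis \<Longrightarrow> grad \<phi> x \<bullet> b = pderiv_dir \<phi> b x"
  by (simp add: grad_def inner_sum_left inner_Basis if_distrib sum.delta cong: if_cong)

lemma abs_pderiv_dir_le: "b \<in> Basis \<Longrightarrow> \<bar>pderiv_dir \<phi> b x\<bar> \<le> norm (grad \<phi> x)"
  by (metis Basis_le_norm grad_inner_Basis)

lemma continuous_on_grad:
  assumes "Ck 1 \<phi>"
  shows "continuous_on UNIV (grad \<phi>)"
  using assms unfolding grad_def[abs_def] by (auto intro!: continuous_intros)

lemma has_real_derivative_along_line:
  assumes "\<phi> differentiable (at (x + t *\<^sub>R b))"
  shows "((\<lambda>t. \<phi> (x + t *\<^sub>R b)) has_real_derivative pderiv_dir \<phi> b (x + t *\<^sub>R b)) (at t)"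
proof -
  let ?D = "frechet_derivative \<phi> (at (x + t *\<^sub>R b))"
  have D: "(\<phi> has_derivative ?D) (at (x + t *\<^sub>R b))"
    using assms frechet_derivative_works by blast
  have "((\<lambda>t. x + t *\<^sub>R b) has_derivative (\<lambda>t. t *\<^sub>R b)) (at t)"
    by (auto intro!: derivative_eq_intros)
  from has_derivative_compose[OF this D]
  have "((\<lambda>t. \<phi> (x + t *\<^sub>R b)) has_derivative (\<lambda>t. ?D (t *\<^sub>R b))) (at t)" .
  moreover have "(\<lambda>t. ?D (t *\<^sub>R b)) = (*) (pderiv_dir \<phi> b (x + t *\<^sub>R b))"
    using has_derivative_linear[OF D] by (auto simp: linear_cmul pderiv_dir_def)
  ultimately show ?thesis by (simp add: has_field_derivative_def)
qed

text \<open>The fundamental theorem of calculus on a segment from a point outside the support to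
  \<open>x\<close>; the integral of the absolute derivative is then extended to the whole
  line.\<close>

lemma abs_powr_le_line_integral:
  fixes \<phi> :: "'a::euclidean_space \<Rightarrow> real"
  assumes \<phi>: "C1_bounded_support \<phi>" and b: "b \<in> Basis" and a: "1 < a"
  shows "ennreal (\<bar>\<phi> x\<bar> powr a)
    \<le> line_integral b (\<lambda>y. ennreal (a * (\<bar>\<phi> y\<bar> powr (a - 1) * norm (grad \<phi> y)))) x"
proof -
  have cont: "continuous_on UNIV \<phi>" "continuous_on UNIV (pderiv_dir \<phi> b)"
    and diff: "\<And>x. \<phi> differentiable (at x)"
    using \<phi> b by (auto simp: C1_bounded_support_def)
  obtain R where R: "\<And>y. R < norm y \<Longrightarrow> \<phi> y = 0" and "0 < R"
    using \<phi> unfolding C1_bounded_support_def bounded_pos by (auto simp: not_le[symmetric])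
  \<comment> \<open>Far enough that the point \<open>x + l *\<^sub>R b\<close> has norm at least
    \<open>R + 1\<close>, hence lies outside the support.\<close>
  define l where "l = - (R + norm x + 1)"
  have "l \<le> 0" using \<open>0 < R\<close> norm_ge_zero[of x] unfolding l_def by linarith
  have "\<phi> (x + l *\<^sub>R b) = 0"
  proof (rule R)
    have "norm (l *\<^sub>R b) \<le> norm (x + l *\<^sub>R b) + norm x"
      by (metis add_diff_cancel_left' norm_triangle_ineq4)
    moreover have "norm (l *\<^sub>R b) = R + norm x + 1"
      using b \<open>l \<le> 0\<close> by simp (simp add: l_def)
    ultimately show "R < norm (x + l *\<^sub>R b)" by simp
  qed
  define v where "v t = \<bar>\<phi> (x + t *\<^sub>R b)\<bar> powr a" for t
  define w where "w t = a * (sgn (\<phi> (x + t *\<^sub>R b)) * \<bar>\<phi> (x + t *\<^sub>R b)\<bar> powr (a - 1)) * pderiv_dir \<phi> b (x + t *\<^sub>R b)" for t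
  have vw: "(v has_real_derivative w t) (at t)" for t
    unfolding v_def[abs_def] w_def
    by (rule DERIV_chain2[OF has_real_derivative_abs_powr[OF a] has_real_derivative_along_line[OF diff]])
  have line: "continuous_on UNIV (\<lambda>t. x + t *\<^sub>R b)"
    by (intro continuous_intros)
  have contw: "continuous_on UNIV w"
    unfolding w_def using a
    by (intro continuous_intros continuous_on_compose2[OF continuous_on_sgn_abs_powr[of "a - 1"]]
        continuous_on_compose2[OF cont(1) line] continuous_on_compose2[OF cont(2) line]) auto
  have bi: "has_bochner_integral lborel (\<lambda>t. w t * indicator {l..0} t) (v 0 - v l)"
    using vw contw \<open>l \<le> 0\<close> by (intro has_bochner_integral_FTC_Icc_real) (auto simp: continuous_on_eq_continuous_at)
  have "ennreal (\<bar>\<phi> x\<bar> powr a) = ennreal (norm (v 0 - v l))"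
    using \<open>\<phi> (x + l *\<^sub>R b) = 0\<close> by (simp add: v_def)
  also have "\<dots> \<le> (\<integral>\<^sup>+t. ennreal (norm (w t * indicator {l..0} t)) \<partial>lborel)"
    using bi integral_norm_bound_ennreal[of lborel "\<lambda>t. w t * indicator {l..0} t"]
    by (auto simp: has_bochner_integral_iff)
  also have "\<dots> \<le> (\<integral>\<^sup>+t. ennreal (a * (\<bar>\<phi> (x + t *\<^sub>R b)\<bar> powr (a - 1) * norm (grad \<phi> (x + t *\<^sub>R b)))) \<partial>lborel)"
  proof (intro nn_integral_mono ennreal_leI)
    fix t
    have "norm (w t * indicator {l..0} t) \<le> \<bar>w t\<bar>"
      by (auto simp: indicator_def)
    also have "\<dots> \<le> a * (\<bar>\<phi> (x + t *\<^sub>R b)\<bar> powr (a - 1) * \<bar>pderiv_dir \<phi> b (x + t *\<^sub>R b)\<bar>)"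
      using a by (auto simp: w_def abs_mult sgn_if)
    also have "\<dots> \<le> a * (\<bar>\<phi> (x + t *\<^sub>R b)\<bar> powr (a - 1) * norm (grad \<phi> (x + t *\<^sub>R b)))"
      using a b by (intro mult_left_mono abs_pderiv_dir_le) auto
    finally show "norm (w t * indicator {l..0} t) \<le> \<dots>" .
  qed
  finally show ?thesis by (simp add: line_integral_def)
qed

text \<open>In logarithms the hypothesis is linear in \<open>ln x\<close>. Moving the terms in
  \<open>ln x\<close> to the left leaves the coefficient \<open>n / p - 1\<close>, which is positive
  because \<open>p < n\<close>, and dividing by it gives the claim.\<close>

lemma Sobolev_absorb_powr:
  fixes x \<tau> c p n :: real
  assumes x: "0 \<le> x" and \<tau>: "0 \<le> \<tau>" and c: "0 < c" and p: "1 < p" "p < n"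
    and le: "x \<le> (c * (x powr (1 - 1/p) * \<tau> powr (1/p))) powr (n / (n - 1))"
  shows "x \<le> c powr (p * n / (n - p)) * \<tau> powr (p * n / (n - p) / p)"
proof (cases "x = 0")
  case False
  then have xp: "0 < x" using x by simp
  \<comment> \<open>For \<open>\<tau> = 0\<close> the right side of the hypothesis would be 0,
    contradicting \<open>0 < x\<close>.\<close>
  have tp: "0 < \<tau>"
    using le xp \<tau> by (cases "\<tau> = 0") auto
  define s where "s = p * n / (n - p)"
  have "ln x \<le> ln ((c * (x powr (1 - 1/p) * \<tau> powr (1/p))) powr (n / (n - 1)))"
    using le xp by (intro ln_mono) auto
  also have "\<dots> = n / (n - 1) * (ln c + ((1 - 1/p) * ln x + (1/p) * ln \<tau>))"
    using xp tp c by (simp add: ln_powr ln_mult)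
  finally have "(n - 1) * ln x \<le> n * (ln c + ((1 - 1/p) * ln x + (1/p) * ln \<tau>))"
    using p by (simp add: pos_le_divide_eq mult.commute)
  then have "(n / p - 1) * ln x \<le> n * ln c + n / p * ln \<tau>"
    by (simp add: algebra_simps)
  moreover have "0 < n / p - 1" using p by (simp add: field_simps)
  ultimately have "ln x \<le> (n * ln c + n / p * ln \<tau>) / (n / p - 1)"
    by (simp add: pos_le_divide_eq mult.commute)
  also have "n / p - 1 = (n - p) / p"
    using p by (simp add: diff_divide_distrib)
  also have "(n * ln c + n / p * ln \<tau>) / ((n - p) / p) = s * ln c + s / p * ln \<tau>"
    using p by (simp add: s_def divide_simps)
  also have "\<dots> = ln (c powr s * \<tau> powr (s / p))"
    using c tp by (simp add: ln_powr ln_mult)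
  finally show ?thesis
    using xp c tp by (simp add: s_def ln_le_cancel_iff)
qed simp

section \<open>The inequality for C^1 functions with bounded support\<close>

lemma nn_integral_norm_powr_finite:
  fixes h :: "'a::euclidean_space \<Rightarrow> 'b::real_normed_vector"
  assumes cont: "continuous_on UNIV h" and bdd: "bounded {x. h x \<noteq> 0}" and a: "0 \<le> a"
  shows "(\<integral>\<^sup>+x. ennreal (norm (h x) powr a) \<partial>lborel) < \<infinity>"
proof -
  obtain R where R: "\<And>y. R < norm y \<Longrightarrow> h y = 0"
    using bdd unfolding bounded_pos by (auto simp: not_le[symmetric])
  have "bounded (h ` cball 0 R)"
    using cont by (intro compact_imp_bounded compact_continuous_image) (auto intro: continuous_on_subset)
  then obtain B where B: "\<And>y. norm y \<le> R \<Longrightarrow> norm (h y) \<le> B"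
    unfolding bounded_iff by force
  have "(\<integral>\<^sup>+x. ennreal (norm (h x) powr a) \<partial>lborel) \<le> (\<integral>\<^sup>+x. ennreal (B powr a) * indicator (cball (0::'a) R) x \<partial>lborel)"
  proof (intro nn_integral_mono)
    fix x
    show "ennreal (norm (h x) powr a) \<le> ennreal (B powr a) * indicator (cball 0 R) x"
      using R[of x] B[of x] a by (cases "norm x \<le> R") (auto intro!: ennreal_leI powr_mono2)
  qed
  also have "\<dots> = ennreal (B powr a) * emeasure lborel (cball (0::'a) R)"
    by (simp add: nn_integral_cmult_indicator)
  also have "\<dots> < \<infinity>"
    using emeasure_bounded_finite[of "cball (0::'a) R"] by (simp add: ennreal_mult_less_top)
  finally show ?thesis .
qed

text \<open>The line bound is applied to \<open>\<bar>\<phi>\<bar> powr \<gamma>\<close>. The choice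
  of \<open>\<gamma>\<close> gives \<open>\<gamma> * N / (N - 1) = ps\<close>, so the product over
  the directions is \<open>\<bar>\<phi>\<bar> powr ps\<close>, and also
  \<open>\<gamma> - 1 = ps * (1 - 1/p)\<close>, so Hoelder on the right side reproduces the same
  integral \<open>X\<close> with a power that can be absorbed.\<close>

lemma Gagliardo_Nirenberg_Sobolev:
  fixes \<phi> :: "'a::euclidean_space \<Rightarrow> real"
  assumes \<phi>: "C1_bounded_support \<phi>" and p: "1 < p" "p < real DIM('a)"
  defines "ps \<equiv> crit_exp p DIM('a)" and "\<gamma> \<equiv> p * (real DIM('a) - 1) / (real DIM('a) - p)"
  shows "(\<integral>\<^sup>+x. ennreal (\<bar>\<phi> x\<bar> powr ps) \<partial>lborel)
    \<le> ennreal (\<gamma> powr ps) * epowr (\<integral>\<^sup>+x. ennreal (norm (grad \<phi> x) powr p) \<partial>lborel) (ps / p)"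
proof -
  define N where "N = real DIM('a)"
  have N: "1 < p" "p < N" "2 \<le> DIM('a)" using p by (auto simp: N_def)
  have ps: "ps = p * N / (N - p)" by (simp add: ps_def crit_exp_def N_def)
  have pspos: "0 < ps" using N by (simp add: ps)
  have \<gamma>: "1 < \<gamma>" using N by (simp add: \<gamma>_def N_def[symmetric] field_simps)
  have ps\<gamma>: "ps = \<gamma> * (1 / (N - 1)) * N" using N by (simp add: ps \<gamma>_def N_def[symmetric])
  have \<gamma>1: "ps * (1 - 1/p) = \<gamma> - 1" using N by (simp add: ps \<gamma>_def N_def[symmetric] field_simps)
  have [measurable]: "\<phi> \<in> borel_measurable borel" "grad \<phi> \<in> borel_measurable borel"
    using \<phi> continuous_on_grad[of \<phi>] by (auto simp: C1_bounded_support_def intro!: borel_measurable_continuous_onI)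
  define X where "X = (\<integral>\<^sup>+x. ennreal (\<bar>\<phi> x\<bar> powr ps) \<partial>lborel)"
  define T where "T = (\<integral>\<^sup>+x. ennreal (norm (grad \<phi> x) powr p) \<partial>lborel)"
  define h where "h y = ennreal (\<gamma> * (\<bar>\<phi> y\<bar> powr (\<gamma> - 1) * norm (grad \<phi> y)))" for y
  have [measurable]: "h \<in> borel_measurable borel" by (simp add: h_def[abs_def])
  have "X \<le> (\<integral>\<^sup>+x. (\<Prod>b\<in>Basis. epowr (line_integral b h x) (1 / (N - 1))) \<partial>lborel)"
    unfolding X_def
  proof (intro nn_integral_mono)
    fix x
    have "ennreal (\<bar>\<phi> x\<bar> powr ps) = (\<Prod>b\<in>(Basis::'a set). epowr (ennreal (\<bar>\<phi> x\<bar> powr \<gamma>)) (1 / (N - 1)))"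
    proof -
      have "\<bar>\<phi> x\<bar> powr ps = (\<bar>\<phi> x\<bar> powr (\<gamma> * (1 / (N - 1)))) ^ DIM('a)"
        unfolding ps\<gamma> N_def by (cases "\<phi> x = 0") (simp_all add: powr_power mult.commute)
      then show ?thesis
        using N by (simp add: epowr_ennreal powr_powr ennreal_power)
    qed
    also have "\<dots> \<le> (\<Prod>b\<in>Basis. epowr (line_integral b h x) (1 / (N - 1)))"
      using N \<gamma> \<phi> by (intro prod_mono_ennreal epowr_mono)
        (auto simp: h_def[abs_def] intro!: abs_powr_le_line_integral)
    finally show "ennreal (\<bar>\<phi> x\<bar> powr ps) \<le> \<dots>" .
  qed
  also have "\<dots> \<le> epowr (\<integral>\<^sup>+x. h x \<partial>lborel) (N / (N - 1))"
    using nn_integral_prod_line_integrals_le[of h] N by (simp add: N_def)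
  finally have XG: "X \<le> epowr (\<integral>\<^sup>+x. h x \<partial>lborel) (N / (N - 1))" .
  \<comment> \<open>The one-element index set turns \<open>Holder_nn_integral_insert\<close> into
    Hoelder's inequality for two functions with weights \<open>1 - 1/p\<close> and
    \<open>1/p\<close>.\<close>
  have "(\<integral>\<^sup>+x. h x \<partial>lborel) = (\<integral>\<^sup>+x. ennreal \<gamma> * (epowr (ennreal (\<bar>\<phi> x\<bar> powr ps)) (1 - 1/p)
      * (\<Prod>i\<in>{()}. epowr (ennreal (norm (grad \<phi> x) powr p)) (1/p))) \<partial>lborel)"
  proof (intro nn_integral_cong)
    fix x
    show "h x = ennreal \<gamma> * (epowr (ennreal (\<bar>\<phi> x\<bar> powr ps)) (1 - 1/p)
      * (\<Prod>i\<in>{()}. epowr (ennreal (norm (grad \<phi> x) powr p)) (1/p)))"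
      using N \<gamma> \<gamma>1 by (simp add: h_def epowr_ennreal powr_powr ennreal_mult[symmetric])
  qed
  also have "\<dots> = ennreal \<gamma> * (\<integral>\<^sup>+x. (epowr (ennreal (\<bar>\<phi> x\<bar> powr ps)) (1 - 1/p)
      * (\<Prod>i\<in>{()}. epowr (ennreal (norm (grad \<phi> x) powr p)) (1/p))) \<partial>lborel)"
    by (rule nn_integral_cmult) measurable
  also have "\<dots> \<le> ennreal \<gamma> * (epowr X (1 - 1/p) * (\<Prod>i\<in>{()}. epowr T (1/p)))"
    unfolding X_def T_def using N by (intro mult_left_mono Holder_nn_integral_insert) auto
  finally have G: "(\<integral>\<^sup>+x. h x \<partial>lborel) \<le> ennreal \<gamma> * (epowr X (1 - 1/p) * epowr T (1/p))"
    by simp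
  have XG': "X \<le> epowr (ennreal \<gamma> * (epowr X (1 - 1/p) * epowr T (1/p))) (N / (N - 1))"
    using N by (intro order_trans[OF XG] epowr_mono G) auto
  \<comment> \<open>Absorbing the power of \<open>X\<close> from the right side is possible only for
    finite \<open>X\<close>.\<close>
  have Xfin: "X < \<infinity>"
    unfolding X_def using nn_integral_norm_powr_finite[of \<phi> ps] \<phi> pspos
    by (simp add: C1_bounded_support_def)
  have "X \<le> ennreal (\<gamma> powr ps) * epowr T (ps / p)"
  proof (cases T)
    case (real \<tau>)
    obtain x where x: "X = ennreal x" "0 \<le> x" using Xfin by (cases X) auto
    have "ennreal x \<le> ennreal ((\<gamma> * (x powr (1 - 1/p) * \<tau> powr (1/p))) powr (N / (N - 1)))"
      using XG' x real N \<gamma> by (simp add: epowr_ennreal ennreal_mult[symmetric])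
    then have "x \<le> (\<gamma> * (x powr (1 - 1/p) * \<tau> powr (1/p))) powr (N / (N - 1))"
      by (subst (asm) ennreal_le_iff) auto
    then have "x \<le> \<gamma> powr ps * \<tau> powr (ps / p)"
      unfolding ps using x real N \<gamma> by (intro Sobolev_absorb_powr) auto
    then show ?thesis
      using x real N pspos by (simp add: epowr_ennreal ennreal_mult[symmetric] ennreal_leI)
  next
    case top
    then show ?thesis using pspos N \<gamma> by (simp add: ennreal_mult_top)
  qed
  then show ?thesis by (simp add: X_def T_def)
qed

section \<open>The Sobolev inequality in \<open>W\<^sub>0\<^sup>1\<^sup>,\<^sup>p\<close>\<close>

lemma test_fun_eq_0: "test_fun \<Omega> \<phi> \<Longrightarrow> x \<notin> \<Omega> \<Longrightarrow> \<phi> x = 0"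
  using closure_subset[of "{x. \<phi> x \<noteq> 0}"] by (auto simp: test_fun_def)

lemma grad_eq_0_outside_support:
  assumes "x \<notin> closure {x. \<phi> x \<noteq> 0}"
  shows "grad \<phi> x = 0"
proof -
  have "(\<phi> has_derivative (\<lambda>_. 0)) (at x)"
  proof (rule has_derivative_transform_within_open[where f="\<lambda>_. 0"])
    show "open (- closure {x. \<phi> x \<noteq> 0})" by (rule open_Compl) simp
    show "\<And>y. y \<in> - closure {x. \<phi> x \<noteq> 0} \<Longrightarrow> 0 = \<phi> y"
      using closure_subset[of "{x. \<phi> x \<noteq> 0}"] by auto
  qed (use assms in auto)
  then have "frechet_derivative \<phi> (at x) = (\<lambda>_. 0)"
    by (metis frechet_derivative_at)
  then show ?thesis by (simp add: grad_def pderiv_dir_def)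
qed

lemma test_fun_grad_eq_0: "test_fun \<Omega> \<phi> \<Longrightarrow> x \<notin> \<Omega> \<Longrightarrow> grad \<phi> x = 0"
  by (auto simp: test_fun_def intro!: grad_eq_0_outside_support)

lemma test_fun_C1_bounded_support: "test_fun \<Omega> \<phi> \<Longrightarrow> C1_bounded_support \<phi>"
  unfolding test_fun_def C1_bounded_support_def smooth_def
  by (meson bounded_subset closure_subset compact_imp_bounded)

lemma test_fun_bounded_grad_support: "test_fun \<Omega> \<phi> \<Longrightarrow> bounded {x. grad \<phi> x \<noteq> 0}"
  using grad_eq_0_outside_support[of _ \<phi>]
  by (intro bounded_subset[of "closure {x. \<phi> x \<noteq> 0}" "{x. grad \<phi> x \<noteq> 0}"])
    (auto simp: test_fun_def compact_imp_bounded)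

lemma test_fun_borel:
  assumes "test_fun \<Omega> \<phi>"
  shows "\<phi> \<in> borel_measurable borel" "grad \<phi> \<in> borel_measurable borel"
  using test_fun_C1_bounded_support[OF assms] continuous_on_grad[of \<phi>]
  by (auto simp: C1_bounded_support_def intro!: borel_measurable_continuous_onI)

lemma borel_measurable_lebesgue_onI:
  "h \<in> borel_measurable borel \<Longrightarrow> h \<in> borel_measurable (lebesgue_on \<Omega>)"
  by (intro measurable_restrict_space1 measurable_completion) simp

lemma nn_integral_lebesgue_on_eq_lborel:
  fixes h :: "'a::euclidean_space \<Rightarrow> ennreal"
  assumes "open \<Omega>" "\<And>x. x \<notin> \<Omega> \<Longrightarrow> h x = 0"
  shows "(\<integral>\<^sup>+x. h x \<partial>lebesgue_on \<Omega>) = (\<integral>\<^sup>+x. h x \<partial>lborel)"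
proof -
  have "\<Omega> \<in> sets lebesgue" using assms(1) by (simp add: lmeasurable_open)
  then have "(\<integral>\<^sup>+x. h x \<partial>lebesgue_on \<Omega>) = (\<integral>\<^sup>+x. h x * indicator \<Omega> x \<partial>lebesgue)"
    by (subst nn_integral_restrict_space) auto
  also have "\<dots> = (\<integral>\<^sup>+x. h x \<partial>lebesgue)"
    using assms(2) by (intro nn_integral_cong) (auto simp: indicator_def)
  finally show ?thesis by (simp add: nn_integral_completion)
qed

text \<open>The norm of the sum is at most twice the larger norm. This crude bound takes the place
  of Minkowski's inequality, at the price of the factor \<open>2 powr p\<close> in the Sobolev
  constant.\<close>

lemma norm_add_powr_le:
  fixes a b :: "'b::real_normed_vector"
  assumes "0 \<le> p"
  shows "norm (a + b) powr p \<le> 2 powr p * (norm a powr p + norm b powr p)"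
proof -
  have "norm (a + b) \<le> 2 * max (norm a) (norm b)"
    using norm_triangle_ineq[of a b] by linarith
  then have "norm (a + b) powr p \<le> (2 * max (norm a) (norm b)) powr p"
    using assms by (intro powr_mono2) auto
  also have "\<dots> = 2 powr p * max (norm a) (norm b) powr p"
    by (simp add: powr_mult)
  also have "\<dots> \<le> 2 powr p * (norm a powr p + norm b powr p)"
    by (intro mult_left_mono) (auto simp: max_def)
  finally show ?thesis .
qed

lemma integrable_norm_diff_powr:
  fixes h k :: "'a \<Rightarrow> 'b::{real_normed_vector, second_countable_topology}"
  assumes [measurable]: "h \<in> borel_measurable M" "k \<in> borel_measurable M" and p: "0 \<le> p"
    and int: "integrable M (\<lambda>x. norm (h x) powr p)" "integrable M (\<lambda>x. norm (k x) powr p)"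
  shows "integrable M (\<lambda>x. norm (h x - k x) powr p)"
proof (rule Bochner_Integration.integrable_bound)
  show "integrable M (\<lambda>x. 2 powr p * (norm (h x) powr p + norm (k x) powr p))"
    using int by simp
  show "AE x in M. norm (norm (h x - k x) powr p) \<le> norm (2 powr p * (norm (h x) powr p + norm (k x) powr p))"
  proof (rule AE_I2)
    show "norm (norm (h x - k x) powr p) \<le> norm (2 powr p * (norm (h x) powr p + norm (k x) powr p))" for x
      using norm_add_powr_le[OF p, of "h x" "- k x"] by simp
  qed
qed measurable

lemma test_fun_integrable_powr:
  assumes \<phi>: "test_fun \<Omega> \<phi>" and \<Omega>: "open \<Omega>" and p: "0 < p"
  shows "integrable (lebesgue_on \<Omega>) (\<lambda>x. norm (\<phi> x) powr p)"
    and "integrable (lebesgue_on \<Omega>) (\<lambda>x. norm (grad \<phi> x) powr p)"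
proof -
  note C1 = test_fun_C1_bounded_support[OF \<phi>]
  have [measurable]: "\<phi> \<in> borel_measurable (lebesgue_on \<Omega>)" "grad \<phi> \<in> borel_measurable (lebesgue_on \<Omega>)"
    using test_fun_borel[OF \<phi>] by (auto intro: borel_measurable_lebesgue_onI)
  have "(\<integral>\<^sup>+x. ennreal (norm (\<phi> x) powr p) \<partial>lebesgue_on \<Omega>) < \<infinity>"
    using p C1 \<Omega> nn_integral_norm_powr_finite[of \<phi> p]
    by (subst nn_integral_lebesgue_on_eq_lborel) (auto simp: test_fun_eq_0[OF \<phi>] C1_bounded_support_def)
  then show "integrable (lebesgue_on \<Omega>) (\<lambda>x. norm (\<phi> x) powr p)"
    by (intro integrableI_bounded) auto
  have "(\<integral>\<^sup>+x. ennreal (norm (grad \<phi> x) powr p) \<partial>lebesgue_on \<Omega>) < \<infinity>"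
    using p C1 \<Omega> nn_integral_norm_powr_finite[of "grad \<phi>" p] continuous_on_grad[of \<phi>] test_fun_bounded_grad_support[OF \<phi>]
    by (subst nn_integral_lebesgue_on_eq_lborel) (auto simp: test_fun_grad_eq_0[OF \<phi>] C1_bounded_support_def)
  then show "integrable (lebesgue_on \<Omega>) (\<lambda>x. norm (grad \<phi> x) powr p)"
    by (intro integrableI_bounded) auto
qed

lemma tendsto_0_of_abs_powr:
  fixes a :: "nat \<Rightarrow> real"
  assumes "0 < p" "(\<lambda>n. \<bar>a n\<bar> powr p) \<longlonglongrightarrow> 0"
  shows "a \<longlonglongrightarrow> 0"
proof -
  have "(\<lambda>n. (\<bar>a n\<bar> powr p) powr (1/p)) \<longlonglongrightarrow> 0"
    by (rule tendsto_zero_powrI[OF assms(2) tendsto_const]) (use assms(1) in auto)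
  then show ?thesis
    using assms(1) by (simp add: powr_powr tendsto_rabs_zero_iff)
qed

text \<open>The inequality for approximating test functions passes to the limit by Fatou's lemma
  along an almost everywhere convergent subsequence. Integrability belongs to the claim, since the
  integral of a non-integrable function is 0 by convention and the estimate alone would then be
  empty.\<close>

lemma Sobolev_inequality:
  fixes \<Omega> :: "'a::euclidean_space set"
  assumes p: "1 < p" "p < real DIM('a)" and \<Omega>: "open \<Omega>"
  defines "ps \<equiv> crit_exp p DIM('a)"
  shows "\<exists>C>0. \<forall>u g. sobolev0 p \<Omega> u g \<longrightarrow>
    integrable (lebesgue_on \<Omega>) (\<lambda>x. \<bar>u x\<bar> powr ps) \<and>
    (\<integral>x. \<bar>u x\<bar> powr ps \<partial>lebesgue_on \<Omega>) \<le> C * grad_norm_p p \<Omega> g powr (ps / p)"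
proof -
  define \<gamma> where "\<gamma> = p * (real DIM('a) - 1) / (real DIM('a) - p)"
  have \<gamma>: "0 < \<gamma>" using p by (simp add: \<gamma>_def)
  have ps: "0 < ps" using p by (simp add: ps_def crit_exp_def)
  let ?L = "lebesgue_on \<Omega>"
  let ?C = "\<gamma> powr ps * (2 powr p) powr (ps / p)"
  have "integrable ?L (\<lambda>x. \<bar>u x\<bar> powr ps) \<and>
      (\<integral>x. \<bar>u x\<bar> powr ps \<partial>?L) \<le> ?C * grad_norm_p p \<Omega> g powr (ps / p)"
    if u: "sobolev0 p \<Omega> u g" for u g
  proof -
    have um[measurable]: "u \<in> borel_measurable ?L" "g \<in> borel_measurable ?L"
      and ui: "integrable ?L (\<lambda>x. norm (u x) powr p)" and gi: "integrable ?L (\<lambda>x. norm (g x) powr p)"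
      using u by (auto simp: sobolev0_def sobolev_def)
    define T where "T = grad_norm_p p \<Omega> g"
    have T: "0 \<le> T" by (simp add: T_def grad_norm_p_def)
    obtain \<phi> where \<phi>: "\<And>k. test_fun \<Omega> (\<phi> k)"
      and \<phi>u: "(\<lambda>k. \<integral>x. \<bar>\<phi> k x - u x\<bar> powr p \<partial>?L) \<longlonglongrightarrow> 0"
      and \<phi>g: "(\<lambda>k. \<integral>x. norm (grad (\<phi> k) x - g x) powr p \<partial>?L) \<longlonglongrightarrow> 0"
      using u by (auto simp: sobolev0_def)
    have [measurable]: "\<phi> k \<in> borel_measurable ?L" "grad (\<phi> k) \<in> borel_measurable ?L" for k
      using test_fun_borel[OF \<phi>] by (auto intro: borel_measurable_lebesgue_onI)
    have iu: "integrable ?L (\<lambda>x. \<bar>\<phi> k x - u x\<bar> powr p)" for k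
      using integrable_norm_diff_powr[of "\<phi> k" ?L u p] test_fun_integrable_powr(1)[OF \<phi> \<Omega>, of p] ui p by simp
    have ig: "integrable ?L (\<lambda>x. norm (grad (\<phi> k) x - g x) powr p)" for k
      using integrable_norm_diff_powr[of "grad (\<phi> k)" ?L g p] test_fun_integrable_powr(2)[OF \<phi> \<Omega>, of p] gi p by simp
    \<comment> \<open>The approximation error of the gradients; it enters the bound
      \<open>c k\<close> and disappears in the limit.\<close>
    define E where "E k = (\<integral>x. norm (grad (\<phi> k) x - g x) powr p \<partial>?L)" for k
    have E: "0 \<le> E k" for k by (simp add: E_def)
    define c where "c k = \<gamma> powr ps * (2 powr p * (E k + T)) powr (ps / p)" for k
    have bound: "(\<integral>\<^sup>+x. ennreal (\<bar>\<phi> k x\<bar> powr ps) \<partial>?L) \<le> ennreal (c k)" for k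
    proof -
      have "(\<integral>\<^sup>+x. ennreal (norm (grad (\<phi> k) x) powr p) \<partial>?L)
          \<le> (\<integral>\<^sup>+x. ennreal (2 powr p * (norm (grad (\<phi> k) x - g x) powr p + norm (g x) powr p)) \<partial>?L)"
      proof (intro nn_integral_mono ennreal_leI)
        show "norm (grad (\<phi> k) x) powr p \<le> 2 powr p * (norm (grad (\<phi> k) x - g x) powr p + norm (g x) powr p)" for x
          using norm_add_powr_le[of p "grad (\<phi> k) x - g x" "g x"] p by simp
      qed
      also have "\<dots> = ennreal (2 powr p * (E k + T))"
        using ig gi by (subst nn_integral_eq_integral) (auto simp: E_def T_def grad_norm_p_def)
      finally have le: "(\<integral>\<^sup>+x. ennreal (norm (grad (\<phi> k) x) powr p) \<partial>?L) \<le> ennreal (2 powr p * (E k + T))" .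
      have "(\<integral>\<^sup>+x. ennreal (\<bar>\<phi> k x\<bar> powr ps) \<partial>?L) = (\<integral>\<^sup>+x. ennreal (\<bar>\<phi> k x\<bar> powr ps) \<partial>lborel)"
        using \<Omega> test_fun_eq_0[OF \<phi>] by (intro nn_integral_lebesgue_on_eq_lborel) auto
      also have "\<dots> \<le> ennreal (\<gamma> powr ps) * epowr (\<integral>\<^sup>+x. ennreal (norm (grad (\<phi> k) x) powr p) \<partial>lborel) (ps / p)"
        unfolding ps_def \<gamma>_def
        by (rule Gagliardo_Nirenberg_Sobolev[OF test_fun_C1_bounded_support[OF \<phi>] p])
      also have "(\<integral>\<^sup>+x. ennreal (norm (grad (\<phi> k) x) powr p) \<partial>lborel) = (\<integral>\<^sup>+x. ennreal (norm (grad (\<phi> k) x) powr p) \<partial>?L)"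
        using \<Omega> test_fun_grad_eq_0[OF \<phi>] by (intro nn_integral_lebesgue_on_eq_lborel[symmetric]) auto
      also have "ennreal (\<gamma> powr ps) * epowr \<dots> (ps / p) \<le> ennreal (\<gamma> powr ps) * epowr (ennreal (2 powr p * (E k + T))) (ps / p)"
        using ps p by (intro mult_left_mono epowr_mono le) auto
      also have "\<dots> = ennreal (c k)"
        using ps p E[of k] T by (simp add: c_def epowr_ennreal ennreal_mult[symmetric])
      finally show ?thesis .
    qed
    have Elim: "E \<longlonglongrightarrow> 0" using \<phi>g by (simp add: E_def[abs_def])
    have "c \<longlonglongrightarrow> \<gamma> powr ps * (2 powr p * (0 + T)) powr (ps / p)"
      unfolding c_def[abs_def] using ps p E T
      by (intro tendsto_mult tendsto_powr' tendsto_add Elim tendsto_const) auto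
    then have clim: "c \<longlonglongrightarrow> ?C * T powr (ps / p)"
      using T by (simp add: powr_mult mult.assoc)
    \<comment> \<open>Convergence in the mean yields pointwise convergence only along a subsequence,
      which suffices for Fatou's lemma.\<close>
    obtain r where r: "strict_mono r" "AE x in ?L. (\<lambda>n. \<bar>\<phi> (r n) x - u x\<bar> powr p) \<longlonglongrightarrow> 0"
      using tendsto_L1_AE_subseq[of ?L "\<lambda>k x. \<bar>\<phi> k x - u x\<bar> powr p"] iu \<phi>u by auto
    have "AE x in ?L. ennreal (\<bar>u x\<bar> powr ps) = liminf (\<lambda>n. ennreal (\<bar>\<phi> (r n) x\<bar> powr ps))"
      using r(2)
    proof eventually_elim
      case (elim x)
      then have "(\<lambda>n. \<phi> (r n) x - u x) \<longlonglongrightarrow> 0"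
        using p by (auto intro: tendsto_0_of_abs_powr[OF _ elim])
      then have "(\<lambda>n. \<phi> (r n) x) \<longlonglongrightarrow> u x"
        by (simp add: LIM_zero_iff)
      then have "(\<lambda>n. \<bar>\<phi> (r n) x\<bar> powr ps) \<longlonglongrightarrow> \<bar>u x\<bar> powr ps"
        using ps by (intro tendsto_powr' tendsto_rabs tendsto_const) auto
      then have "(\<lambda>n. ennreal (\<bar>\<phi> (r n) x\<bar> powr ps)) \<longlonglongrightarrow> ennreal (\<bar>u x\<bar> powr ps)"
        by (rule tendsto_ennrealI)
      then show ?case
        by (rule lim_imp_Liminf[OF sequentially_bot, symmetric])
    qed
    then have "(\<integral>\<^sup>+x. ennreal (\<bar>u x\<bar> powr ps) \<partial>?L) = (\<integral>\<^sup>+x. liminf (\<lambda>n. ennreal (\<bar>\<phi> (r n) x\<bar> powr ps)) \<partial>?L)"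
      by (rule nn_integral_cong_AE)
    also have "\<dots> \<le> liminf (\<lambda>n. \<integral>\<^sup>+x. ennreal (\<bar>\<phi> (r n) x\<bar> powr ps) \<partial>?L)"
      by (rule nn_integral_liminf) measurable
    also have "\<dots> \<le> liminf (\<lambda>n. ennreal (c (r n)))"
      by (intro Liminf_mono always_eventually allI bound)
    also have "\<dots> = ennreal (?C * T powr (ps / p))"
      using tendsto_ennrealI[OF LIMSEQ_subseq_LIMSEQ[OF clim r(1), unfolded o_def]]
      by (rule lim_imp_Liminf[OF sequentially_bot])
    finally have fin: "(\<integral>\<^sup>+x. ennreal (\<bar>u x\<bar> powr ps) \<partial>?L) \<le> ennreal (?C * T powr (ps / p))" .
    have int: "integrable ?L (\<lambda>x. \<bar>u x\<bar> powr ps)"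
      using le_less_trans[OF fin ennreal_less_top] by (intro integrableI_bounded) auto
    moreover have "(\<integral>x. \<bar>u x\<bar> powr ps \<partial>?L) \<le> ?C * T powr (ps / p)"
      using fin by (subst (asm) nn_integral_eq_integral[OF int]) auto
    ultimately show ?thesis by (simp add: T_def)
  qed
  moreover have "0 < ?C" using \<gamma> by simp
  ultimately show ?thesis by blast
qed

section \<open>Nonexistence of nontrivial solutions\<close>

text \<open>The Sobolev constant bounds the set of quotients from above, so the real supremum is a
  true upper bound.\<close>

lemma Sobolev_inequality_sobolev_S:
  fixes \<Omega> :: "'a::euclidean_space set"
  assumes p: "1 < p" "p < real DIM('a)" and \<Omega>: "open \<Omega>"
    and u: "sobolev0 p \<Omega> u g" and pos: "0 < grad_norm_p p \<Omega> g"
  shows "(\<integral>x. \<bar>u x\<bar> powr crit_exp p DIM('a) \<partial>lebesgue_on \<Omega>)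
    \<le> sobolev_S p \<Omega> * grad_norm_p p \<Omega> g powr (crit_exp p DIM('a) / p)"
proof -
  define ps where "ps = crit_exp p DIM('a)"
  let ?A = "{(\<integral>x. \<bar>u x\<bar> powr ps \<partial>lebesgue_on \<Omega>) / (grad_norm_p p \<Omega> g) powr (ps / p) | u g.
          sobolev0 p \<Omega> u g \<and> grad_norm_p p \<Omega> g > 0}"
  obtain C where C: "\<And>u g. sobolev0 p \<Omega> u g \<Longrightarrow>
      (\<integral>x. \<bar>u x\<bar> powr ps \<partial>lebesgue_on \<Omega>) \<le> C * grad_norm_p p \<Omega> g powr (ps / p)"
    using Sobolev_inequality[OF p \<Omega>] unfolding ps_def by blast
  have "bdd_above ?A"
    by (rule bdd_aboveI[of _ C]) (auto simp: pos_divide_le_eq C)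
  then have "(\<integral>x. \<bar>u x\<bar> powr ps \<partial>lebesgue_on \<Omega>) / (grad_norm_p p \<Omega> g) powr (ps / p) \<le> Sup ?A"
    using u pos by (intro cSup_upper) auto
  then show ?thesis
    using pos by (simp add: sobolev_S_def Let_def ps_def pos_divide_le_eq)
qed

text \<open>Below the level \<open>s\<close> the power is monotone; above it
  \<open>t powr (p - r)\<close> is at most \<open>s powr (p - r)\<close>, the exponent being
  negative.\<close>

lemma powr_le_split:
  fixes t s p r :: real
  assumes "0 \<le> t" "0 < s" "0 < p" "p < r"
  shows "t powr p \<le> s powr p + s powr (p - r) * t powr r"
proof (cases "t \<le> s")
  case True
  then have "t powr p \<le> s powr p"
    using assms by (intro powr_mono2) auto
  then show ?thesis by (simp add: add_increasing2)
next
  case False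
  have "t powr p = t powr (p - r) * t powr r"
    using False assms by (simp add: powr_add[symmetric])
  also have "\<dots> \<le> s powr (p - r) * t powr r"
    using False assms by (intro mult_right_mono powr_mono2') auto
  finally show ?thesis by (simp add: add_increasing)
qed

text \<open>On a domain of finite measure the critical Sobolev bound controls the
  \<open>p\<close>-th power as well, by splitting the values of \<open>u\<close> at a level
  \<open>s\<close>.\<close>

lemma Poincare_inequality:
  fixes \<Omega> :: "'a::euclidean_space set"
  assumes p: "1 < p" "p < real DIM('a)" and \<Omega>: "open \<Omega>" "bounded \<Omega>"
  shows "\<exists>C>0. \<forall>u g. sobolev0 p \<Omega> u g \<longrightarrow> 0 < grad_norm_p p \<Omega> g \<longrightarrow>
    (\<integral>x. \<bar>u x\<bar> powr p \<partial>lebesgue_on \<Omega>) \<le> C * grad_norm_p p \<Omega> g"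
proof -
  define ps where "ps = crit_exp p DIM('a)"
  have ps: "p < ps"
    using p by (simp add: ps_def crit_exp_def pos_less_divide_eq)
  obtain C where "0 < C" and C: "\<And>u g. sobolev0 p \<Omega> u g \<Longrightarrow>
      integrable (lebesgue_on \<Omega>) (\<lambda>x. \<bar>u x\<bar> powr ps) \<and>
      (\<integral>x. \<bar>u x\<bar> powr ps \<partial>lebesgue_on \<Omega>) \<le> C * grad_norm_p p \<Omega> g powr (ps / p)"
    using Sobolev_inequality[OF p \<Omega>(1)] unfolding ps_def by blast
  define V where "V = measure (lebesgue_on \<Omega>) \<Omega>"
  interpret finite_measure "lebesgue_on \<Omega>"
    using \<Omega> by (intro finite_measure_lebesgue_on lmeasurable_open)
  have "(\<integral>x. \<bar>u x\<bar> powr p \<partial>lebesgue_on \<Omega>) \<le> (V + C) * grad_norm_p p \<Omega> g"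
    if u: "sobolev0 p \<Omega> u g" and pos: "0 < grad_norm_p p \<Omega> g" for u g
  proof -
    define T where "T = grad_norm_p p \<Omega> g"
    \<comment> \<open>This level makes both parts linear in \<open>T\<close>: the small values
      contribute \<open>V * T\<close>, the large ones
      \<open>C * s powr (p - ps) * T powr (ps / p) = C * T\<close>.\<close>
    define s where "s = T powr (1/p)"
    have "0 < T" using pos by (simp add: T_def)
    have s: "s powr p = T" "0 < s" "s powr (p - ps) * T powr (ps / p) = T"
      using \<open>0 < T\<close> p by (auto simp: s_def powr_powr powr_add[symmetric] field_simps)
    have "(\<integral>x. \<bar>u x\<bar> powr p \<partial>lebesgue_on \<Omega>)
        \<le> (\<integral>x. s powr p + s powr (p - ps) * \<bar>u x\<bar> powr ps \<partial>lebesgue_on \<Omega>)"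
      using u C[OF u] p ps s(2)
      by (intro integral_mono powr_le_split) (auto simp: sobolev0_def sobolev_def)
    also have "\<dots> = T * V + s powr (p - ps) * (\<integral>x. \<bar>u x\<bar> powr ps \<partial>lebesgue_on \<Omega>)"
      using C[OF u] by (simp add: s V_def)
    also have "\<dots> \<le> T * V + s powr (p - ps) * (C * T powr (ps / p))"
      using C[OF u] by (intro add_left_mono mult_left_mono) (auto simp: T_def)
    also have "\<dots> = (V + C) * T"
      using s(3) by (simp add: algebra_simps)
    finally show ?thesis by (simp add: T_def)
  qed
  moreover have "0 < V + C" using \<open>0 < C\<close> by (simp add: V_def add_nonneg_pos)
  ultimately show ?thesis by blast
qed

text \<open>The strict gap in the infimum condition yields an excess
  \<open>d * t powr \<kappa>\<close> over \<open>S * t powr \<kappa>\<close>, which degenerates as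
  \<open>t\<close> tends to 0. There the positive limit of \<open>M\<close> supplies a constant
  excess instead.\<close>

lemma Kirchhoff_lower_bound:
  fixes M :: "real \<Rightarrow> real"
  assumes M_nonneg: "\<forall>t\<ge>0. M t \<ge> 0" and rho1: "\<exists>L>0. (M \<longlongrightarrow> L) (at_right 0)"
    and \<kappa>: "0 < \<kappa>" and gamma1: "(INF t\<in>{0<..}. M t / t powr \<kappa>) > S"
  shows "\<exists>c>0. \<forall>t>0. M t \<ge> S * t powr \<kappa> + c * (1 + t powr \<kappa>)"
proof -
  define m where "m = (INF t\<in>{0<..}. M t / t powr \<kappa>)"
  define d where "d = m - S"
  have "0 < d" using gamma1 by (simp add: d_def m_def)
  have M1: "S * t powr \<kappa> + d * t powr \<kappa> \<le> M t" if "0 < t" for t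
  proof -
    have "m \<le> M t / t powr \<kappa>"
      unfolding m_def using M_nonneg that by (intro cINF_lower bdd_belowI2[of _ 0]) auto
    then show ?thesis
      using that by (simp add: pos_le_divide_eq d_def algebra_simps)
  qed
  obtain L where L: "0 < L" "(M \<longlongrightarrow> L) (at_right 0)" using rho1 by auto
  have "((\<lambda>t. t powr \<kappa>) \<longlongrightarrow> 0) (at_right 0)"
    using \<kappa> by (intro tendsto_zero_powrI[OF tendsto_ident_at tendsto_const]) (auto simp: eventually_at_filter)
  then have "((\<lambda>t. M t - S * t powr \<kappa>) \<longlongrightarrow> L - S * 0) (at_right 0)"
    by (intro tendsto_intros L)
  then have "\<forall>\<^sub>F t in at_right 0. L / 2 < M t - S * t powr \<kappa>"
    using \<open>0 < L\<close> by (intro order_tendstoD(1)[of _ L]) auto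
  then obtain t0 where t0: "0 < t0" "\<And>t. 0 < t \<Longrightarrow> t < t0 \<Longrightarrow> L / 2 < M t - S * t powr \<kappa>"
    by (auto simp: eventually_at_right_field)
  \<comment> \<open>The first entry serves for \<open>t < t0\<close>, the second for
    \<open>t \<ge> t0\<close>, where the excess in \<open>M1\<close> is at least its value at
    \<open>t0\<close>.\<close>
  define e where "e = min (L / 2) (d * t0 powr \<kappa>)"
  have "0 < e" using L t0 \<open>0 < d\<close> by (simp add: e_def)
  have M2: "S * t powr \<kappa> + e \<le> M t" if "0 < t" for t
  proof (cases "t < t0")
    case True
    then show ?thesis using t0(2)[OF that] by (simp add: e_def min_def)
  next
    case False
    then have "d * t0 powr \<kappa> \<le> d * t powr \<kappa>"
      using \<open>0 < d\<close> t0 \<kappa> by (intro mult_left_mono powr_mono2) auto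
    then show ?thesis using M1[OF that] by (simp add: e_def min_def)
  qed
  \<comment> \<open>The average of \<open>M1\<close> and \<open>M2\<close>, which accounts for the
    factor 1/2.\<close>
  define c where "c = min d e / 2"
  have "S * t powr \<kappa> + c * (1 + t powr \<kappa>) \<le> M t" if "0 < t" for t
  proof -
    have "2 * (c * (1 + t powr \<kappa>)) = min d e + min d e * t powr \<kappa>"
      by (simp add: c_def algebra_simps)
    also have "\<dots> \<le> e + d * t powr \<kappa>"
      by (intro add_mono mult_right_mono) auto
    finally show ?thesis using M1[OF that] M2[OF that] by argo
  qed
  moreover have "0 < c" using \<open>0 < d\<close> \<open>0 < e\<close> by (simp add: c_def)
  ultimately show ?thesis by blast
qed

text \<open>Near 0 the smallness condition with \<epsilon> = 1 gives the power \<open>p\<close>; for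
  \<open>\<bar>t\<bar> \<ge> \<delta>\<close> the growth condition applies and all lower powers are
  dominated by the power \<open>ps\<close>.\<close>

lemma nonlinearity_upper_bound:
  fixes f :: "'a::euclidean_space \<Rightarrow> real \<Rightarrow> real"
  assumes p: "1 < p" "p < ps"
    and f1: "\<exists>c1>0. \<exists>c2>0. \<exists>q. p < q \<and> q < ps \<and>
               (AE x in lebesgue_on \<Omega>. \<forall>t. \<bar>f x t\<bar> \<le> c1 + c2 * \<bar>t\<bar> powr (q - 1))"
    and f2: "\<forall>\<epsilon>>0. \<exists>\<delta>>0. \<forall>x\<in>\<Omega>. \<forall>t. 0 < \<bar>t\<bar> \<and> \<bar>t\<bar> < \<delta> \<longrightarrow> \<bar>f x t\<bar> / \<bar>t\<bar> powr (p - 1) < \<epsilon>"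
  shows "\<exists>K>0. AE x in lebesgue_on \<Omega>. \<forall>t. f x t * t \<le> K * (\<bar>t\<bar> powr p + \<bar>t\<bar> powr ps)"
proof -
  obtain c1 c2 q where c: "0 < c1" "0 < c2" and q: "p < q" "q < ps"
    and f: "AE x in lebesgue_on \<Omega>. \<forall>t. \<bar>f x t\<bar> \<le> c1 + c2 * \<bar>t\<bar> powr (q - 1)"
    using f1 by blast
  obtain \<delta> where \<delta>: "0 < \<delta>" "\<And>x t. x \<in> \<Omega> \<Longrightarrow> 0 < \<bar>t\<bar> \<Longrightarrow> \<bar>t\<bar> < \<delta> \<Longrightarrow> \<bar>f x t\<bar> / \<bar>t\<bar> powr (p - 1) < 1"
    using f2[rule_format, of 1] by auto
  \<comment> \<open>The summand 1 serves for \<open>\<bar>t\<bar> < \<delta>\<close>; the bracket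
    collects the constants from replacing \<open>\<bar>t\<bar>\<close> and
    \<open>\<bar>t\<bar> powr q\<close> by multiples of
    \<open>\<bar>t\<bar> powr ps\<close>.\<close>
  define K where "K = 1 + (c1 * \<delta> powr (1 - ps) + c2 * \<delta> powr (q - ps))"
  have K: "1 \<le> K" using c by (simp add: K_def)
  have abs_mult_powr: "\<bar>t\<bar> * \<bar>t\<bar> powr (a - 1) = \<bar>t\<bar> powr a" if "t \<noteq> 0" for t a :: real
    using that powr_add[of "\<bar>t\<bar>" 1 "a - 1"] by simp
  have "AE x in lebesgue_on \<Omega>. x \<in> \<Omega>" using AE_space[of "lebesgue_on \<Omega>"] by simp
  then have "AE x in lebesgue_on \<Omega>. \<forall>t. f x t * t \<le> K * (\<bar>t\<bar> powr p + \<bar>t\<bar> powr ps)"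
    using f
  proof eventually_elim
    case (elim x)
    show ?case
    proof
      fix t
      consider "t = 0" | "t \<noteq> 0" "\<bar>t\<bar> < \<delta>" | "\<delta> \<le> \<bar>t\<bar>" by linarith
      then show "f x t * t \<le> K * (\<bar>t\<bar> powr p + \<bar>t\<bar> powr ps)"
      proof cases
        case 2
        have "\<bar>f x t\<bar> \<le> \<bar>t\<bar> powr (p - 1)"
          using \<delta>(2)[OF elim(1), of t] 2 by (simp add: pos_divide_less_eq)
        then have "\<bar>t\<bar> * \<bar>f x t\<bar> \<le> \<bar>t\<bar> * \<bar>t\<bar> powr (p - 1)"
          by (intro mult_left_mono) auto
        then have "f x t * t \<le> \<bar>t\<bar> powr p"
          using abs_mult_powr[of t p] 2 abs_ge_self[of "f x t * t"] by (simp add: abs_mult mult.commute)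
        also have "\<dots> \<le> 1 * (\<bar>t\<bar> powr p + \<bar>t\<bar> powr ps)" by simp
        also have "\<dots> \<le> K * (\<bar>t\<bar> powr p + \<bar>t\<bar> powr ps)"
          using K by (intro mult_right_mono) auto
        finally show ?thesis .
      next
        case 3
        have t: "0 < \<bar>t\<bar>" using 3 \<delta>(1) by linarith
        have low: "\<bar>t\<bar> powr a \<le> \<delta> powr (a - ps) * \<bar>t\<bar> powr ps" if "a < ps" for a
        proof -
          have "\<bar>t\<bar> powr a = \<bar>t\<bar> powr (a - ps) * \<bar>t\<bar> powr ps"
            using t by (simp add: powr_add[symmetric])
          also have "\<dots> \<le> \<delta> powr (a - ps) * \<bar>t\<bar> powr ps"
            using that 3 \<delta>(1) by (intro mult_right_mono powr_mono2') auto
          finally show ?thesis .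
        qed
        have "f x t * t \<le> \<bar>t\<bar> * \<bar>f x t\<bar>"
          using abs_ge_self[of "f x t * t"] by (simp add: abs_mult mult.commute)
        also have "\<dots> \<le> \<bar>t\<bar> * (c1 + c2 * \<bar>t\<bar> powr (q - 1))"
          using elim(2) by (intro mult_left_mono) auto
        also have "\<dots> = c1 * \<bar>t\<bar> powr 1 + c2 * \<bar>t\<bar> powr q"
          using abs_mult_powr[of t q] t by (simp add: algebra_simps)
        also have "\<dots> \<le> c1 * (\<delta> powr (1 - ps) * \<bar>t\<bar> powr ps) + c2 * (\<delta> powr (q - ps) * \<bar>t\<bar> powr ps)"
          using c p q by (intro add_mono mult_left_mono low) auto
        also have "\<dots> = (K - 1) * \<bar>t\<bar> powr ps"
          by (simp add: K_def algebra_simps)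
        also have "\<dots> \<le> K * (\<bar>t\<bar> powr p + \<bar>t\<bar> powr ps)"
          using K by (intro mult_mono) auto
        finally show ?thesis .
      qed simp
    qed
  qed
  then show ?thesis using K by (intro exI[of _ K]) auto
qed

theorem theorem1p1:
  fixes \<Omega> :: "'a::euclidean_space set"
    and p :: real
    and M :: "real \<Rightarrow> real"
    and f :: "'a \<Rightarrow> real \<Rightarrow> real"
  assumes p_gt1: "1 < p" and p_ltN: "p < real DIM('a)"
    and dom: "smooth_bounded_domain \<Omega>"
    and M_nonneg: "\<forall>t\<ge>0. M t \<ge> 0"
    and M_C1: "\<exists>M'. continuous_on {0..} M' \<and> (\<forall>t\<ge>0. (M has_real_derivative M' t) (at t within {0..}))"
    and rho1: "\<exists>L>0. (M \<longlongrightarrow> L) (at_right 0)"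
    and rho2: "\<exists>r>crit_exp p DIM('a). \<exists>L::ereal. L > 0 \<and>
                 ((\<lambda>t. ereal (M t / t powr ((r - p) / p))) \<longlongrightarrow> L) at_top"
    and gamma1: "(INF t\<in>{0<..}. M t / t powr (crit_exp p DIM('a) / p - 1)) > sobolev_S p \<Omega>"
    and f_meas: "\<forall>t. (\<lambda>x. f x t) \<in> borel_measurable (lebesgue_on \<Omega>)"
    and f_C1: "\<forall>x\<in>\<Omega>. \<exists>f'. continuous_on UNIV f' \<and> (\<forall>t. (f x has_real_derivative f' t) (at t))"
    and f1: "\<exists>c1>0. \<exists>c2>0. \<exists>q. p < q \<and> q < crit_exp p DIM('a) \<and>
               (AE x in lebesgue_on \<Omega>. \<forall>t. \<bar>f x t\<bar> \<le> c1 + c2 * \<bar>t\<bar> powr (q - 1))"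
    and f2: "\<forall>\<epsilon>>0. \<exists>\<delta>>0. \<forall>x\<in>\<Omega>. \<forall>t. 0 < \<bar>t\<bar> \<and> \<bar>t\<bar> < \<delta> \<longrightarrow> \<bar>f x t\<bar> / \<bar>t\<bar> powr (p - 1) < \<epsilon>"
    and f3: "(AE x in lebesgue_on \<Omega>. (\<forall>t>0. f x t > 0) \<and> (\<forall>t<0. f x t < 0)) \<and>
             (\<exists>\<mu>>0. \<exists>a b. 0 \<le> a \<and> a < b \<and> (AE x in lebesgue_on \<Omega>. \<forall>t\<in>{a<..<b}. f x t \<ge> \<mu>))"
  shows "\<exists>lam1>0. \<forall>lam<lam1. \<forall>u g. weak_solution p \<Omega> M f lam u g \<longrightarrow> (AE x in lebesgue_on \<Omega>. u x = 0)"
proof -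
  let ?L = "lebesgue_on \<Omega>"
  define ps where "ps = crit_exp p DIM('a)"
  define S where "S = sobolev_S p \<Omega>"
  have \<Omega>: "open \<Omega>" "bounded \<Omega>" using dom by (auto simp: smooth_bounded_domain_def)
  have ps: "p < ps"
    using p_gt1 p_ltN by (simp add: ps_def crit_exp_def pos_less_divide_eq)
  obtain c where c: "0 < c" "\<And>t. 0 < t \<Longrightarrow> M t \<ge> S * t powr (ps / p - 1) + c * (1 + t powr (ps / p - 1))"
    using Kirchhoff_lower_bound[OF M_nonneg rho1 _ gamma1] p_gt1 ps unfolding ps_def S_def by auto
  obtain K where K: "0 < K" "AE x in ?L. \<forall>t. f x t * t \<le> K * (\<bar>t\<bar> powr p + \<bar>t\<bar> powr ps)"
    using nonlinearity_upper_bound[OF p_gt1 ps f1[folded ps_def] f2] by auto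
  obtain C1 where C1: "0 < C1" "\<And>u g. sobolev0 p \<Omega> u g \<Longrightarrow>
      integrable ?L (\<lambda>x. \<bar>u x\<bar> powr ps) \<and> (\<integral>x. \<bar>u x\<bar> powr ps \<partial>?L) \<le> C1 * grad_norm_p p \<Omega> g powr (ps / p)"
    using Sobolev_inequality[OF p_gt1 p_ltN \<Omega>(1)] unfolding ps_def by blast
  obtain C2 where C2: "0 < C2" "\<And>u g. sobolev0 p \<Omega> u g \<Longrightarrow> 0 < grad_norm_p p \<Omega> g \<Longrightarrow>
      (\<integral>x. \<bar>u x\<bar> powr p \<partial>?L) \<le> C2 * grad_norm_p p \<Omega> g"
    using Poincare_inequality[OF p_gt1 p_ltN \<Omega>] by blast
  \<comment> \<open>Here \<open>c\<close> measures the excess of \<open>M\<close>, while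
    \<open>K * (C1 + C2)\<close> bounds the integral of \<open>f x (u x) * u x\<close> relative to
    \<open>T + T powr (ps / p)\<close>.\<close>
  define lam1 where "lam1 = c / (K * (C1 + C2))"
  have "AE x in ?L. u x = 0"
    if lam: "lam < lam1" and sol: "weak_solution p \<Omega> M f lam u g" for lam u g
  proof -
    have u: "sobolev0 p \<Omega> u g" using sol by (simp add: weak_solution_def)
    have um[measurable]: "u \<in> borel_measurable ?L" and up: "integrable ?L (\<lambda>x. \<bar>u x\<bar> powr p)"
      using u by (auto simp: sobolev0_def sobolev_def)
    define T where "T = grad_norm_p p \<Omega> g"
    define X where "X = (\<integral>x. \<bar>u x\<bar> powr ps \<partial>?L)"
    define Y where "Y = (\<integral>x. f x (u x) * u x \<partial>?L)"
    have Xint: "integrable ?L (\<lambda>x. \<bar>u x\<bar> powr ps)" and X: "X \<le> C1 * T powr (ps / p)"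
      using C1(2)[OF u] by (auto simp: X_def T_def)
    have T0: "0 \<le> T" by (simp add: T_def grad_norm_p_def)
    \<comment> \<open>Also valid where the gradient vanishes and \<open>p < 2\<close>, because
      \<open>0 powr a\<close> is 0 for every exponent.\<close>
    have g_eq: "norm (g x) powr (p - 2) * (g x \<bullet> g x) = norm (g x) powr p" for x
      by (cases "g x = 0") (simp_all add: powr_diff power2_norm_eq_inner[symmetric])
    have u_eq: "\<bar>u x\<bar> powr (ps - 2) * u x * u x = \<bar>u x\<bar> powr ps" for x
      by (cases "u x = 0") (simp_all add: powr_diff power2_eq_square)
    \<comment> \<open>The pair \<open>u\<close>, \<open>g\<close> is itself an admissible test
      pair.\<close>
    have eq: "M T * T = X + lam * Y"
    proof -
      have "M T * (\<integral>x. norm (g x) powr (p - 2) * (g x \<bullet> g x) \<partial>?L)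
        = (\<integral>x. \<bar>u x\<bar> powr (ps - 2) * u x * u x \<partial>?L) + lam * (\<integral>x. f x (u x) * u x \<partial>?L)"
        using sol u unfolding weak_solution_def ps_def T_def by blast
      then show ?thesis
        unfolding g_eq u_eq by (simp add: X_def Y_def T_def grad_norm_p_def)
    qed
    have "\<not> 0 < T"
    proof
      assume T: "0 < T"
      have "Y \<ge> 0"
        unfolding Y_def
      proof (rule integral_nonneg_AE)
        show "AE x in ?L. 0 \<le> f x (u x) * u x"
          using conjunct1[OF f3]
        proof eventually_elim
          case (elim x)
          then show ?case by (cases "u x" "0::real" rule: linorder_cases) (auto simp: less_imp_le mult_nonpos_nonpos)
        qed
      qed
      have "Y \<le> (\<integral>x. K * (\<bar>u x\<bar> powr p + \<bar>u x\<bar> powr ps) \<partial>?L)"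
      proof -
        have int: "integrable ?L (\<lambda>x. K * (\<bar>u x\<bar> powr p + \<bar>u x\<bar> powr ps))"
          using up Xint by simp
        show ?thesis
        \<comment> \<open>If the product is not integrable, \<open>Y\<close> is 0 by convention and
          lies below the nonnegative right side.\<close>
        proof (cases "integrable ?L (\<lambda>x. f x (u x) * u x)")
          case True
          then show ?thesis
            unfolding Y_def using int K(2) by (intro integral_mono_AE) auto
        next
          case False
          then show ?thesis
            using K(1) by (simp add: Y_def not_integrable_integral_eq)
        qed
      qed
      also have "\<dots> = K * ((\<integral>x. \<bar>u x\<bar> powr p \<partial>?L) + X)"
        using up Xint by (simp add: X_def)
      also have "\<dots> \<le> K * (C2 * T + C1 * T powr (ps / p))"
        using K(1) C2(2)[OF u] T X by (intro mult_left_mono add_mono) (auto simp: T_def)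
      also have "\<dots> \<le> K * ((C1 + C2) * T + (C1 + C2) * T powr (ps / p))"
        using K(1) C1(1) C2(1) T by (intro mult_left_mono add_mono mult_right_mono) auto
      finally have Y: "Y \<le> K * (C1 + C2) * (T + T powr (ps / p))"
        by (simp add: algebra_simps)
      have Tp: "T powr (ps / p - 1) * T = T powr (ps / p)"
        using T by (simp add: powr_diff)
      have XS: "X \<le> S * T powr (ps / p)"
        using Sobolev_inequality_sobolev_S[OF p_gt1 p_ltN \<Omega>(1) u] T
        by (simp add: X_def T_def S_def ps_def)
      have "(S * T powr (ps / p - 1) + c * (1 + T powr (ps / p - 1))) * T \<le> M T * T"
        using c(2)[OF T] T by (intro mult_right_mono) auto
      moreover have "(S * T powr (ps / p - 1) + c * (1 + T powr (ps / p - 1))) * T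
          = S * T powr (ps / p) + c * (T + T powr (ps / p))"
        using Tp by (simp add: algebra_simps)
      \<comment> \<open>The terms with \<open>S\<close> cancel: the critical integral
        \<open>X\<close> uses up exactly the part \<open>S * T powr (ps / p)\<close> of
        \<open>M T * T\<close>.\<close>
      ultimately have main: "c * (T + T powr (ps / p)) \<le> lam * Y"
        using eq XS by linarith
      have pos: "0 < T + T powr (ps / p)" using T by (simp add: add_pos_nonneg)
      show False
      \<comment> \<open>For nonpositive \<open>lam\<close> the sign of \<open>Y\<close> is enough;
        for positive \<open>lam\<close> the upper bound on \<open>Y\<close> and the choice of
        \<open>lam1\<close> decide.\<close>
      proof (cases "lam \<le> 0")
        case True
        then have "lam * Y \<le> 0" using \<open>Y \<ge> 0\<close> by (simp add: mult_nonpos_nonneg)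
        moreover have "0 < c * (T + T powr (ps / p))" using c(1) pos by simp
        ultimately show False using main by linarith
      next
        case False
        have "lam * Y \<le> lam * (K * (C1 + C2) * (T + T powr (ps / p)))"
          using False Y by (intro mult_left_mono) auto
        also have "\<dots> = (lam * (K * (C1 + C2))) * (T + T powr (ps / p))" by simp
        also have "\<dots> < c * (T + T powr (ps / p))"
          using lam K(1) C1(1) C2(1) pos by (intro mult_strict_right_mono) (auto simp: lam1_def pos_less_divide_eq)
        finally show False using main by linarith
      qed
    qed
    \<comment> \<open>With a vanishing gradient integral the bound by \<open>C1\<close> forces
      \<open>X = 0\<close>; the supremum \<open>S\<close> ranges only over positive gradient
      integrals and does not cover this case.\<close>
    then have "T = 0" using T0 by simp
    then have "X = 0"
      using X by (simp add: X_def antisym)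
    then have "AE x in ?L. \<bar>u x\<bar> powr ps = 0"
      using integral_nonneg_eq_0_iff_AE[OF Xint] by (simp add: X_def)
    then show ?thesis by eventually_elim simp
  qed
  moreover have "0 < lam1" using c(1) K(1) C1(1) C2(1) by (simp add: lam1_def)
  ultimately show ?thesis by blast
qed

end
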